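(* Let $n\ge1$, $\varepsilon\in\{+,-\}^{n-1}$, and $w=\varepsilon_{n-1}\cdots\varepsilon_1$. For every $R\subseteq[n]$ with $n\in R$ and every $k\in[n]$, there are explicit bijections $$\mathcal M_w(k;R)\longleftrightarrow\mathfrak S_{\varepsilon,R}(k)\longleftrightarrow\mathcal L_k(Q_{\varepsilon,R}).$$ In particular, $|\mathcal M_w(k;R)|=|\mathfrak S_{\varepsilon,R}(k)|=\ell_{\varepsilon,R}(k)$. Moreover, with $r=n-1$, $$r!\,\mathscr K_w^{(p,q)}(x;y_{n-1},y_{n-2},\ldots,y_1)=\sum_{k=1}^{n}\ \sum_{\substack{R\subseteq[n]\\ n\in R}}\ell_{\varepsilon,R}(k)\,p^{|R_\varepsilon^+(R)|}q^{|R_\varepsilon^-(R)|}\,\mathbf y^{R\setminus\{n\}}B_{r,k}(x).$$ Consequently, $$y_n\,n!\int_0^1\mathscr K_w^{(p,q)}(x;y_{n-1},\ldots,y_1)\,\mathrm{d}x=\sum_{\pi\in S_n}\mathbf y^{\operatorname{Rec}_\varepsilon(\pi)}p^{\operatorname{rec}_\varepsilon^+(\pi)}q^{\operatorname{rec}_\varepsilon^-(\pi)}=\sum_{\substack{R\subseteq[n]\\ n\in R}}\mathbf y^R p^{|R_\varepsilon^+(R)|}q^{|R_\varepsilon^-(R)|}\,|\mathcal L(Q_{\varepsilon,R})|.$$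
   Context: Here $p,q,y_1,\ldots,y_n$ are indeterminates, $\mathbf y^A=\prod_{i\in A}y_i$, and $B_{r,k}(x)=\binom r{k-1}x^{k-1}(1-x)^{r+1-k}$. Greedy records: for $\pi\in S_n$, set $i_0=n$; once $i_j$ is chosen, let $A_j(\pi)$ be the set of $i<i_j$ such that $\pi_i>\pi_{i_j}$ if $\varepsilon_i=+$, and $\pi_i<\pi_{i_j}$ if $\varepsilon_i=-$; stop if it is empty, otherwise $i_{j+1}=\max A_j(\pi)$. $\operatorname{Rec}_\varepsilon(\pi)=\{i_0,\ldots,i_s\}$; $\operatorname{rec}_\varepsilon^{\pm}(\pi)=\#\{1\le j\le s:\varepsilon_{i_j}=\pm\}$. For $R\subseteq[n]$ with $n\in R$: $R_\varepsilon^{\pm}(R)=\{i\in R\cap[n-1]:\varepsilon_i=\pm\}$, and $\mathfrak S_{\varepsilon,R}(k)=\{\pi\in S_n:\operatorname{Rec}_\varepsilon(\pi)=R,\ \pi_n=k\}$. Record poset: for $i<n$ let $\rho_R(i)=\min\{r\in R:r>i\}$. $Q_{\varepsilon,R}$ is the poset on $[n]$ that is the transitive closure of the following relations, one for each $i<n$: $i<\rho_R(i)$ if ($\varepsilon_i=+$ and $i\notin R$) or ($\varepsilon_i=-$ and $i\in R$); otherwise $\rho_R(i)<i$. $\mathcal L(Q)$ is the set of linear extensions of a poset $Q$ on $[n]$, written as words $\sigma=\sigma_1\cdots\sigma_n$ (permutations of $[n]$ in which $a$ occurs before $b$ whenever $a<_Qb$); $\mathcal L_k(Q)=\{\sigma\in\mathcal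 L(Q):\sigma_k=n\}$; $\ell_{\varepsilon,R}(k)=|\mathcal L_k(Q_{\varepsilon,R})|$. Decorated endpoint paths: for $w=w_1\cdots w_r$, $1\le k\le r+1$, $\mathcal M_w(k)$ is the set of pairs $(g,\theta)$ where $g=(g_0,\ldots,g_r)\in[r+1]^{r+1}$, $g_0=k$, $g_i\ge g_{i-1}$ if $w_i=+$, $g_i\le g_{i-1}$ if $w_i=-$, and, with $S_+(g)=\{i:w_i=+,g_i>g_{i-1}\}$, $S_-(g)=\{i:w_i=-,g_i<g_{i-1}\}$, $E(g)=\{i:g_i=g_{i-1}\}$, $\theta$ assigns to each $i\in E(g)$ a value $\theta_i\in[r+1]$ with $\theta_i<g_{i-1}$ if $w_i=+$ and $\theta_i>g_{i-1}$ if $w_i=-$, such that the list of $g_0$, the $g_i$ ($i\in S_+(g)\cup S_-(g)$) and the $\theta_i$ ($i\in E(g)$) is a rearrangement of $[r+1]$. With $J(g)=S_+(g)\cup S_-(g)$ and $n=r+1$, $\mathcal M_w(k;R)=\{(g,\theta)\in\mathcal M_w(k):\{n-j:j\in J(g)\}=R\setminus\{n\}\}$. The polynomials $\mathscr K_w^{(p,q)}(x;z_1,\ldots,z_r)$, for $w\in\{+,-\}^r$, are defined by $\mathscr K_\varnothing^{(p,q)}(x;\varnothing)=1$ and, with $\mathbf z'=(z_2,\ldots,z_r)$, $$\mathscr K_{+v}^{(p,q)}(x;z_1,\mathbf z')=x\mathscr K_v^{(p,q)}(x;\mathbf z')+pz_1\int_x^1\mathscr K_v^{(p,q)}(u;\mathbf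 z')\,\mathrm{d}u,$$ $$\mathscr K_{-v}^{(p,q)}(x;z_1,\mathbf z')=(1-x)\mathscr K_v^{(p,q)}(x;\mathbf z')+qz_1\int_0^x\mathscr K_v^{(p,q)}(u;\mathbf z')\,\mathrm{d}u.$$ *)

theory Defs
  imports
    "HOL-Library.Poly_Mapping"
    "HOL-Library.Multiset"
    "HOL-Combinatorics.Permutations"
    "HOL-Computational_Algebra.Polynomial"
begin

datatype sign = Plus | Minus

text \<open>
  A sign word with letters indexed by \<open>1, \<dots>, n - 1\<close> is given as a function
  \<open>\<epsilon> :: nat \<Rightarrow> sign\<close>, of which only the values on \<open>{1..n-1}\<close> are ever used.  The words \<open>w\<close>
  that index the polynomials and the paths are lists, so the paper's \<open>w\<^sub>i\<close> is \<open>w ! (i - 1)\<close>.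
\<close>

definition rev_word :: "nat \<Rightarrow> (nat \<Rightarrow> 'a) \<Rightarrow> 'a list" where
  "rev_word n f = map f (rev [1..<n])"
  \<comment> \<open>\<open>[f (n-1), f (n-2), \<dots>, f 1]\<close>\<close>


section \<open>Greedy records\<close>

definition candidates :: "(nat \<Rightarrow> sign) \<Rightarrow> (nat \<Rightarrow> nat) \<Rightarrow> nat \<Rightarrow> nat set" where
  "candidates \<epsilon> \<pi> m =
     {i. 1 \<le> i \<and> i < m \<and> (case \<epsilon> i of Plus \<Rightarrow> \<pi> i > \<pi> m | Minus \<Rightarrow> \<pi> i < \<pi> m)}"

lemma candidates_Max_less:
  assumes "candidates \<epsilon> \<pi> m \<noteq> {}"
  shows "Max (candidates \<epsilon> \<pi> m) < m"
proof -
  have "finite (candidates \<epsilon> \<pi> m)"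
    by (rule finite_subset[of _ "{..<m}"]) (auto simp: candidates_def)
  from Max_in[OF this assms] show ?thesis by (auto simp: candidates_def)
qed

function record_seq :: "(nat \<Rightarrow> sign) \<Rightarrow> (nat \<Rightarrow> nat) \<Rightarrow> nat \<Rightarrow> nat list" where
  "record_seq \<epsilon> \<pi> m =
     m # (if candidates \<epsilon> \<pi> m = {} then [] else record_seq \<epsilon> \<pi> (Max (candidates \<epsilon> \<pi> m)))"
  by pat_completeness auto
termination
  by (relation "measure (\<lambda>(\<epsilon>, \<pi>, m). m)") (auto simp: candidates_Max_less)

declare record_seq.simps [simp del]

definition Rec :: "nat \<Rightarrow> (nat \<Rightarrow> sign) \<Rightarrow> (nat \<Rightarrow> nat) \<Rightarrow> nat set" where
  "Rec n \<epsilon> \<pi> = set (record_seq \<epsilon> \<pi> n)"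

definition rec_count :: "sign \<Rightarrow> nat \<Rightarrow> (nat \<Rightarrow> sign) \<Rightarrow> (nat \<Rightarrow> nat) \<Rightarrow> nat" where
  "rec_count s n \<epsilon> \<pi> =
     card {j. 1 \<le> j \<and> j < length (record_seq \<epsilon> \<pi> n) \<and> \<epsilon> (record_seq \<epsilon> \<pi> n ! j) = s}"

definition Rsub :: "sign \<Rightarrow> nat \<Rightarrow> (nat \<Rightarrow> sign) \<Rightarrow> nat set \<Rightarrow> nat set" where
  "Rsub s n \<epsilon> R = {i \<in> R \<inter> {1..n-1}. \<epsilon> i = s}"

definition perms_with :: "nat \<Rightarrow> (nat \<Rightarrow> sign) \<Rightarrow> nat set \<Rightarrow> nat \<Rightarrow> (nat \<Rightarrow> nat) set" where
  "perms_with n \<epsilon> R k = {\<pi>. \<pi> permutes {1..n} \<and> Rec n \<epsilon> \<pi> = R \<and> \<pi> n = k}"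


section \<open>Record posets and their linear extensions\<close>

definition next_rec :: "nat set \<Rightarrow> nat \<Rightarrow> nat" where
  "next_rec R i = Min {r \<in> R. r > i}"

text \<open>Posets are represented by their strict order relation.\<close>

definition record_poset :: "nat \<Rightarrow> (nat \<Rightarrow> sign) \<Rightarrow> nat set \<Rightarrow> (nat \<times> nat) set" where
  "record_poset n \<epsilon> R =
     (let up = (\<lambda>i. (\<epsilon> i = Plus \<and> i \<notin> R) \<or> (\<epsilon> i = Minus \<and> i \<in> R))
      in ({(i, next_rec R i) | i. 1 \<le> i \<and> i < n \<and> up i} \<union>
          {(next_rec R i, i) | i. 1 \<le> i \<and> i < n \<and> \<not> up i})\<^sup>+)"

text \<open>The word \<open>\<sigma>\<^sub>1 \<dots> \<sigma>\<^sub>n\<close> is the permutation \<open>\<sigma>\<close>, whose value at a position is the letter there.\<close>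

definition lin_exts :: "nat \<Rightarrow> (nat \<times> nat) set \<Rightarrow> (nat \<Rightarrow> nat) set" where
  "lin_exts n Q =
     {\<sigma>. \<sigma> permutes {1..n} \<and> (\<forall>i\<in>{1..n}. \<forall>j\<in>{1..n}. (\<sigma> i, \<sigma> j) \<in> Q \<longrightarrow> i < j)}"

definition lin_exts_at :: "nat \<Rightarrow> (nat \<times> nat) set \<Rightarrow> nat \<Rightarrow> (nat \<Rightarrow> nat) set" where
  "lin_exts_at n Q k = {\<sigma> \<in> lin_exts n Q. \<sigma> k = n}"

definition ell :: "nat \<Rightarrow> (nat \<Rightarrow> sign) \<Rightarrow> nat set \<Rightarrow> nat \<Rightarrow> nat" where
  "ell n \<epsilon> R k = card (lin_exts_at n (record_poset n \<epsilon> R) k)"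


section \<open>Decorated endpoint paths\<close>

definition strict_plus :: "sign list \<Rightarrow> nat list \<Rightarrow> nat set" where
  "strict_plus w g = {i\<in>{1..length w}. w ! (i - 1) = Plus \<and> g ! i > g ! (i - 1)}"

definition strict_minus :: "sign list \<Rightarrow> nat list \<Rightarrow> nat set" where
  "strict_minus w g = {i\<in>{1..length w}. w ! (i - 1) = Minus \<and> g ! i < g ! (i - 1)}"

definition flat_steps :: "sign list \<Rightarrow> nat list \<Rightarrow> nat set" where
  "flat_steps w g = {i\<in>{1..length w}. g ! i = g ! (i - 1)}"

definition jumps :: "sign list \<Rightarrow> nat list \<Rightarrow> nat set" where
  "jumps w g = strict_plus w g \<union> strict_minus w g"

text \<open>
  The path \<open>g\<close> is the list \<open>[g\<^sub>0, \<dots>, g\<^sub>r]\<close>, and \<open>\<theta>\<close> is a partial map whose domain is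
  the set of flat steps.
\<close>

definition paths :: "sign list \<Rightarrow> nat \<Rightarrow> (nat list \<times> (nat \<rightharpoonup> nat)) set" where
  "paths w k = {(g, \<theta>). let r = length w; E = flat_steps w g in
     length g = r + 1 \<and> set g \<subseteq> {1..r+1} \<and> g ! 0 = k \<and>
     (\<forall>i\<in>{1..r}. (w ! (i - 1) = Plus \<longrightarrow> g ! i \<ge> g ! (i - 1)) \<and>
                  (w ! (i - 1) = Minus \<longrightarrow> g ! i \<le> g ! (i - 1))) \<and>
     dom \<theta> = E \<and>
     (\<forall>i\<in>E. the (\<theta> i) \<in> {1..r+1} \<and>
             (w ! (i - 1) = Plus \<longrightarrow> the (\<theta> i) < g ! (i - 1)) \<and>
             (w ! (i - 1) = Minus \<longrightarrow> the (\<theta> i) > g ! (i - 1))) \<and>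
     {#g ! 0#} + image_mset (\<lambda>i. g ! i) (mset_set (jumps w g))
               + image_mset (\<lambda>i. the (\<theta> i)) (mset_set E) = mset_set {1..r+1}}"

definition paths_with :: "sign list \<Rightarrow> nat \<Rightarrow> nat set \<Rightarrow> (nat list \<times> (nat \<rightharpoonup> nat)) set" where
  "paths_with w k R =
     (let n = length w + 1
      in {(g, \<theta>) \<in> paths w k. (\<lambda>j. n - j) ` jumps w g = R - {n}})"

text \<open>
  The permutation of a decorated path: \<open>\<pi>\<^bsub>n-j\<^esub>\<close> is \<open>\<theta>\<^sub>j\<close> if \<open>j\<close> is a flat
  step and \<open>g\<^sub>j\<close> otherwise.  The second bijection of the theorem is inversion of permutations.
\<close>

definition path_perm :: "nat \<Rightarrow> nat list \<times> (nat \<rightharpoonup> nat) \<Rightarrow> nat \<Rightarrow> nat" where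
  "path_perm n = (\<lambda>(g, \<theta>) m.
     if m \<in> {1..n} then (case \<theta> (n - m) of Some t \<Rightarrow> t | None \<Rightarrow> g ! (n - m)) else m)"


section \<open>The polynomials\<close>

text \<open>
  The ring of polynomials over the rationals in the indeterminates \<open>p\<close>, \<open>q\<close> and
  \<open>y\<^sub>i\<close>.  The variable \<open>x\<close> is the variable of the type \<open>coeffs poly\<close>.
\<close>

datatype indet = Ind_p | Ind_q | Ind_y nat

text \<open>An arbitrary linear order, so that the coefficient ring is an instance of \<open>idom\<close>.\<close>

fun indet_rank :: "indet \<Rightarrow> nat" where
  "indet_rank Ind_p = 0"
| "indet_rank Ind_q = 1"
| "indet_rank (Ind_y i) = i + 2"

lemma indet_rank_inj: "indet_rank a = indet_rank b \<Longrightarrow> a = b"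
  by (cases a; cases b) auto

instantiation indet :: linorder
begin

definition less_eq_indet :: "indet \<Rightarrow> indet \<Rightarrow> bool" where
  "a \<le> b \<longleftrightarrow> indet_rank a \<le> indet_rank b"

definition less_indet :: "indet \<Rightarrow> indet \<Rightarrow> bool" where
  "a < b \<longleftrightarrow> indet_rank a < indet_rank b"

instance
  by standard (auto simp: less_eq_indet_def less_indet_def intro: indet_rank_inj)

end

type_synonym coeffs = "(indet \<Rightarrow>\<^sub>0 nat) \<Rightarrow>\<^sub>0 rat"

definition Indet :: "indet \<Rightarrow> coeffs" where
  "Indet v = Poly_Mapping.single (Poly_Mapping.single v 1) 1"

definition Const :: "rat \<Rightarrow> coeffs" where
  "Const c = Poly_Mapping.single 0 c"

abbreviation p_var :: coeffs where "p_var \<equiv> Indet Ind_p"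
abbreviation q_var :: coeffs where "q_var \<equiv> Indet Ind_q"
abbreviation y_var :: "nat \<Rightarrow> coeffs" where "y_var i \<equiv> Indet (Ind_y i)"

definition y_mon :: "nat set \<Rightarrow> coeffs" where
  "y_mon A = (\<Prod>i\<in>A. y_var i)"

abbreviation X :: "coeffs poly" where "X \<equiv> [:0, 1:]"

text \<open>Integration in \<open>x\<close> is formal, because the coefficients contain indeterminates.\<close>

definition antideriv :: "coeffs poly \<Rightarrow> coeffs poly" where
  "antideriv f = (\<Sum>i\<le>degree f. monom (Const (1 / of_nat (Suc i)) * coeff f i) (Suc i))"

lemma pderiv_antideriv: "pderiv (antideriv f) = f"
proof -
  have of_nat_Const: "of_nat m = Const (of_nat m)" for m
    by (simp add: Const_def single_of_nat)
  have cancel: "of_nat (Suc i) * (Const (1 / of_nat (Suc i)) * c) = c" for i c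
  proof -
    have "of_nat (Suc i) * Const (1 / of_nat (Suc i)) = 1"
      unfolding of_nat_Const by (simp add: Const_def mult_single del: of_nat_Suc single_of_nat)
    then show ?thesis by (simp add: mult.assoc[symmetric] del: of_nat_Suc)
  qed
  have "pderiv (\<Sum>i\<in>A. monom (Const (1 / of_nat (Suc i)) * coeff f i) (Suc i)) =
          (\<Sum>i\<in>A. monom (coeff f i) i)" if "finite A" for A
    using that by induction (simp_all add: pderiv_add pderiv_monom cancel del: of_nat_Suc)
  then show ?thesis
    by (simp add: antideriv_def poly_as_sum_of_monoms)
qed

lemma poly_antideriv_0: "poly (antideriv f) 0 = 0"
  by (simp add: antideriv_def poly_sum poly_monom)

text \<open>The integral of \<open>f(u) du\<close> from \<open>a\<close> to \<open>b\<close>; the limits may depend on \<open>x\<close>.\<close>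

definition integ :: "coeffs poly \<Rightarrow> coeffs poly \<Rightarrow> coeffs poly \<Rightarrow> coeffs poly" where
  "integ a b f = pcompose (antideriv f) b - pcompose (antideriv f) a"

text \<open>Only the case of equally long lists \<open>w\<close> and \<open>zs\<close> is specified.\<close>

fun K :: "coeffs \<Rightarrow> coeffs \<Rightarrow> sign list \<Rightarrow> coeffs list \<Rightarrow> coeffs poly" where
  "K p q [] [] = 1"
| "K p q (Plus # v) (z # zs) = X * K p q v zs + smult (p * z) (integ X 1 (K p q v zs))"
| "K p q (Minus # v) (z # zs) = (1 - X) * K p q v zs + smult (q * z) (integ 0 X (K p q v zs))"

definition Bern :: "nat \<Rightarrow> nat \<Rightarrow> coeffs poly" where
  "Bern r k = of_nat (r choose (k - 1)) * X ^ (k - 1) * (1 - X) ^ (r + 1 - k)"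

end

theory Submission
  imports Defs "HOL-Combinatorics.Multiset_Permutations"
begin

text \<open>
  The three families are three descriptions of one local condition.  Reading a permutation from
  position \<open>n\<close> downwards, the only memory that the greedy procedure needs is the value at
  the last record: position \<open>i\<close> becomes a record exactly when its value lies on the side
  prescribed by \<open>\<epsilon> i\<close> of the value at the last record, which is the next record to
  the right of \<open>i\<close>.  Hence \<open>Rec n \<epsilon> \<pi> = R\<close> iff for every
  \<open>i < n\<close> the comparison of \<open>\<pi> i\<close> with \<open>\<pi> (next_rec R i)\<close> comes out
  as membership of \<open>i\<close> in \<open>R\<close> demands (\<open>Rec_eq_iff\<close>).  Since the values are
  distinct, these are exactly the generating relations of the record poset, imposed on
  \<open>\<pi>\<close> as inequalities of values; so the inverses of the permutations with record set
  \<open>R\<close> are its linear extensions.  A decorated path is the same process written with its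
  memory: \<open>g\<^sub>i\<close> is the value at the last record after \<open>i\<close> steps, a jump is a
  new record, and \<open>\<theta>\<^sub>i\<close> stores the value of a position that is not a record.

  For the polynomials, one sums the weights of the records over all arrangements of a finite set
  \<open>S\<close> of values read after a last record value \<open>a\<close>.  Only the relative order of the
  values matters, so the sum depends on \<open>card S\<close> and on the rank of \<open>a\<close> in
  \<open>S\<close> alone, and splitting off the first value read gives a recurrence
  (\<open>arrangement_sum_eq_endpoint_sum\<close>): a value that does not become a record leaves
  \<open>a\<close> in place and costs a factor that counts the choices, while a new record can have any
  rank on the correct side.  In the Bernstein basis the operators that define the polynomials act
  in the same way.  Multiplication by \<open>x\<close> or \<open>1 - x\<close> sends a Bernstein polynomial
  of degree \<open>m\<close> to a multiple of a single one of degree \<open>m + 1\<close>, and up to the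
  factor \<open>m + 1\<close> its integral from \<open>x\<close> to \<open>1\<close>, or from \<open>0\<close> to
  \<open>x\<close>, is an initial or a final partial sum of the basis of degree \<open>m + 1\<close>
  (\<open>integ_bern\<close>).  So both sides satisfy the same recurrence
  (\<open>fact_K_eq_sum_bern\<close>).  The integral formula follows because all Bernstein polynomials
  of the same degree have the same integral over the unit interval.
\<close>

section \<open>Scanning a permutation for greedy records\<close>

definition beats :: "sign \<Rightarrow> nat \<Rightarrow> nat \<Rightarrow> bool" where
  "beats s b a = (case s of Plus \<Rightarrow> b > a | Minus \<Rightarrow> b < a)"

text \<open>
  The list holds the values at the positions \<open>m, m - 1, \<dots>, 1\<close>, and \<open>a\<close> is the
  value at the last record.  The position of an entry is recovered as the length of the list that
  starts with it, so the scan needs no position counter.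
\<close>

fun scan :: "(nat \<Rightarrow> sign) \<Rightarrow> nat \<Rightarrow> nat list \<Rightarrow> nat set" where
  "scan \<epsilon> a [] = {}"
| "scan \<epsilon> a (b # bs) =
     (if beats (\<epsilon> (Suc (length bs))) b a
      then insert (Suc (length bs)) (scan \<epsilon> b bs) else scan \<epsilon> a bs)"

lemma length_rev_word [simp]: "length (rev_word n f) = n - 1"
  by (simp add: rev_word_def)

lemma rev_word_nth: "i < n - 1 \<Longrightarrow> rev_word n f ! i = f (n - 1 - i)"
  by (simp add: rev_word_def rev_nth Suc_diff_Suc)

lemma rev_word_1 [simp]: "rev_word (Suc 0) f = []"
  by (simp add: rev_word_def)

lemma rev_word_Suc [simp]: "rev_word (Suc (Suc m)) f = f (Suc m) # rev_word (Suc m) f"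
  by (simp add: rev_word_def)

lemma scan_subset: "scan \<epsilon> a bs \<subseteq> {1..length bs}"
proof (induction bs arbitrary: a)
  case (Cons b bs)
  have "{1..length bs} \<subseteq> {1..length (b # bs)}" by auto
  with Cons[of a] Cons[of b] have "scan \<epsilon> a bs \<subseteq> {1..length (b # bs)}"
    and "scan \<epsilon> b bs \<subseteq> {1..length (b # bs)}" by blast+
  then show ?case by simp
qed simp

lemma finite_scan [simp]: "finite (scan \<epsilon> a bs)"
  by (rule finite_subset[OF scan_subset]) simp

text \<open>
  The greedy procedure jumps to the largest candidate, whereas the scan looks at every position.
  They agree because a position between two consecutive records is not a candidate of the later
  one; the hypothesis that no candidate of \<open>m\<close> exceeds \<open>i\<close> records that the scan
  has passed the positions above \<open>i\<close> without success.
\<close>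

lemma set_record_seq_scan:
  assumes "i < m" "candidates \<epsilon> \<pi> m \<subseteq> {..i}"
  shows "set (record_seq \<epsilon> \<pi> m) = insert m (scan \<epsilon> (\<pi> m) (rev_word (Suc i) \<pi>))"
  using assms
proof (induction i arbitrary: m)
  case 0
  then have "candidates \<epsilon> \<pi> m = {}" by (auto simp: candidates_def)
  then show ?case by (simp add: record_seq.simps[of \<epsilon> \<pi> m])
next
  case (Suc i)
  have iff: "Suc i \<in> candidates \<epsilon> \<pi> m \<longleftrightarrow> beats (\<epsilon> (Suc i)) (\<pi> (Suc i)) (\<pi> m)"
    using Suc.prems(1) by (simp add: candidates_def beats_def)
  show ?case
  proof (cases "beats (\<epsilon> (Suc i)) (\<pi> (Suc i)) (\<pi> m)")
    case True
    with iff Suc.prems(2) have "Max (candidates \<epsilon> \<pi> m) = Suc i"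
      by (intro Max_eqI) (auto intro: finite_subset[of _ "{..Suc i}"])
    moreover from True iff have "candidates \<epsilon> \<pi> m \<noteq> {}" by auto
    moreover have "set (record_seq \<epsilon> \<pi> (Suc i)) =
        insert (Suc i) (scan \<epsilon> (\<pi> (Suc i)) (rev_word (Suc i) \<pi>))"
      by (rule Suc.IH) (auto simp: candidates_def)
    ultimately show ?thesis using True by (simp add: record_seq.simps[of \<epsilon> \<pi> m])
  next
    case False
    with iff Suc.prems(2) have "candidates \<epsilon> \<pi> m \<subseteq> {..i}"
      by (metis atMost_Suc subset_insert)
    with False Suc show ?thesis by simp
  qed
qed

lemma Rec_eq_scan:
  assumes "n \<ge> 1"
  shows "Rec n \<epsilon> \<pi> = insert n (scan \<epsilon> (\<pi> n) (rev_word n \<pi>))"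
proof -
  have "candidates \<epsilon> \<pi> n \<subseteq> {..n - 1}" by (auto simp: candidates_def)
  then show ?thesis using set_record_seq_scan[of "n - 1" n \<epsilon> \<pi>] assms by (simp add: Rec_def)
qed

lemma Rec_subset: "n \<ge> 1 \<Longrightarrow> Rec n \<epsilon> \<pi> \<subseteq> {1..n}"
  and n_in_Rec: "n \<ge> 1 \<Longrightarrow> n \<in> Rec n \<epsilon> \<pi>"
  by (auto simp: Rec_eq_scan dest!: subsetD[OF scan_subset])

lemma next_rec_in: "finite R \<Longrightarrow> n \<in> R \<Longrightarrow> i < n \<Longrightarrow> next_rec R i \<in> R \<and> i < next_rec R i"
proof -
  assume "finite R" "n \<in> R" "i < n"
  then have "finite {r \<in> R. i < r}" "{r \<in> R. i < r} \<noteq> {}" by auto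
  from Min_in[OF this] show ?thesis by (simp add: next_rec_def)
qed

lemma next_rec_Suc_in: "finite R \<Longrightarrow> Suc i \<in> R \<Longrightarrow> next_rec R i = Suc i"
  unfolding next_rec_def by (rule Min_eqI) auto

lemma next_rec_Suc_notin: "Suc i \<notin> R \<Longrightarrow> next_rec R i = next_rec R (Suc i)"
  unfolding next_rec_def by (metis Suc_lessD Suc_lessI)

text \<open>
  Both sides determine \<open>R\<close> from the right: the position of the next record says which value
  the scan remembers on arrival at \<open>i\<close>.  The proof compares, for every \<open>i\<close>, the part
  of \<open>R\<close> up to \<open>i\<close> with the rest of the scan from there.
\<close>

lemma Rec_eq_iff:
  assumes "n \<ge> 1" "R \<subseteq> {1..n}" "n \<in> R"
  shows "Rec n \<epsilon> \<pi> = R \<longleftrightarrow>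
    (\<forall>i\<in>{1..<n}. i \<in> R \<longleftrightarrow> beats (\<epsilon> i) (\<pi> i) (\<pi> (next_rec R i)))"
    (is "_ \<longleftrightarrow> ?local")
proof -
  have fin: "finite R" using assms(2) finite_subset by blast
  define P where "P i \<longleftrightarrow> R \<inter> {1..i} = scan \<epsilon> (\<pi> (next_rec R i)) (rev_word (Suc i) \<pi>)" for i
  have last: "next_rec R (n - 1) = n"
    using assms next_rec_Suc_in[OF fin, of "n - 1"] by simp
  have n_notin: "n \<notin> R \<inter> {1..n-1}" "n \<notin> scan \<epsilon> (\<pi> n) (rev_word n \<pi>)"
    using assms(1) by (auto dest!: subsetD[OF scan_subset])
  have "{1..n} = insert n {1..n-1}" using assms(1) by auto
  then have R: "R = insert n (R \<inter> {1..n-1})" using assms(2,3) by auto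
  have "Rec n \<epsilon> \<pi> = R \<longleftrightarrow>
      insert n (scan \<epsilon> (\<pi> n) (rev_word n \<pi>)) = insert n (R \<inter> {1..n-1})"
    using R Rec_eq_scan[OF assms(1)] by simp
  also have "\<dots> \<longleftrightarrow> scan \<epsilon> (\<pi> n) (rev_word n \<pi>) = R \<inter> {1..n-1}"
    by (rule insert_ident[OF n_notin(2,1)])
  also have "\<dots> \<longleftrightarrow> P (n - 1)"
    using assms(1) unfolding P_def last by auto
  finally have Rec_iff: "Rec n \<epsilon> \<pi> = R \<longleftrightarrow> P (n - 1)" .
  have below: "Suc i \<notin> scan \<epsilon> a (rev_word (Suc i) \<pi>)" for a i
    by (auto dest!: subsetD[OF scan_subset])
  have insert_step: "R \<inter> {1..Suc i} =
      (if Suc i \<in> R then insert (Suc i) (R \<inter> {1..i}) else R \<inter> {1..i})" for i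
    by (auto simp: le_Suc_eq)
  have step: "P (Suc i) \<longleftrightarrow>
      P i \<and> (Suc i \<in> R \<longleftrightarrow> beats (\<epsilon> (Suc i)) (\<pi> (Suc i)) (\<pi> (next_rec R (Suc i))))" for i
  proof (cases "Suc i \<in> R")
    case True
    have new: "Suc i \<notin> R \<inter> {1..i}" by simp
    show ?thesis
      using True below[of i "\<pi> (next_rec R (Suc i))"]
        insert_ident[OF new below[of i "\<pi> (Suc i)"]]
      unfolding P_def insert_step next_rec_Suc_in[OF fin True] by auto
  next
    case False
    then show ?thesis
      unfolding P_def insert_step next_rec_Suc_notin[OF False] by auto
  qed
  have "P i \<longleftrightarrow> (\<forall>j\<in>{1..i}. j \<in> R \<longleftrightarrow> beats (\<epsilon> j) (\<pi> j) (\<pi> (next_rec R j)))" for i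
  proof (induction i)
    case 0
    show ?case by (simp add: P_def)
  next
    case (Suc i)
    have "{1..Suc i} = insert (Suc i) {1..i}" by auto
    with step Suc show ?case by auto
  qed
  moreover have "{1..n-1} = {1..<n}" by auto
  ultimately show ?thesis by (simp add: Rec_iff)
qed

section \<open>Linear extensions of the record poset\<close>

text \<open>
  Read through the inverse, a linear extension is a labelling \<open>\<pi>\<close> that increases along
  the poset.  This can be tested on the generating relations, one for each \<open>i < n\<close>, and
  there it is the local condition of \<open>Rec_eq_iff\<close>: as \<open>\<pi>\<close> is injective, failing
  to be on one side of \<open>\<pi> (next_rec R i)\<close> means being strictly on the other.
\<close>

lemma inv_in_lin_exts_iff:
  assumes "n \<ge> 1" "R \<subseteq> {1..n}" "n \<in> R" and \<pi>: "\<pi> permutes {1..n}"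
  shows "inv \<pi> \<in> lin_exts n (record_poset n \<epsilon> R) \<longleftrightarrow> Rec n \<epsilon> \<pi> = R"
proof -
  have fin: "finite R" using assms(2) finite_subset by blast
  define up where "up i \<longleftrightarrow> (\<epsilon> i = Plus \<and> i \<notin> R) \<or> (\<epsilon> i = Minus \<and> i \<in> R)" for i
  define G where "G = {(i, next_rec R i) | i. 1 \<le> i \<and> i < n \<and> up i} \<union>
          {(next_rec R i, i) | i. 1 \<le> i \<and> i < n \<and> \<not> up i}"
  have Q: "record_poset n \<epsilon> R = G\<^sup>+"
    by (simp add: record_poset_def G_def up_def)
  have next_R: "next_rec R i \<in> {1..n}" "i < next_rec R i" if "i < n" for i
    using next_rec_in[OF fin assms(3) that] assms(2) by auto
  then have "G \<subseteq> {1..n} \<times> {1..n}" by (auto simp: G_def)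
  then have G_field: "G\<^sup>+ \<subseteq> {1..n} \<times> {1..n}" by (rule trancl_subset_Sigma)
  have ne: "\<pi> i \<noteq> \<pi> (next_rec R i)" if "i < n" for i
    using next_R(2)[OF that] by (simp add: inj_eq[OF permutes_inj[OF \<pi>]])
  have "inv \<pi> \<in> lin_exts n (record_poset n \<epsilon> R) \<longleftrightarrow>
      (\<forall>i\<in>{1..n}. \<forall>j\<in>{1..n}. (inv \<pi> i, inv \<pi> j) \<in> G\<^sup>+ \<longrightarrow> i < j)"
    using permutes_inv[OF \<pi>] by (simp add: lin_exts_def Q)
  also have "\<dots> \<longleftrightarrow> (\<forall>a b. (a, b) \<in> G\<^sup>+ \<longrightarrow> \<pi> a < \<pi> b)" (is "?inv \<longleftrightarrow> ?mono")
  proof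
    assume ?inv
    show ?mono
    proof (intro allI impI)
      fix a b assume ab: "(a, b) \<in> G\<^sup>+"
      then have "\<pi> a \<in> {1..n}" "\<pi> b \<in> {1..n}" using G_field permutes_in_image[OF \<pi>] by auto
      with \<open>?inv\<close> ab show "\<pi> a < \<pi> b" by (simp add: permutes_inverses[OF \<pi>])
    qed
  next
    assume ?mono
    show ?inv
    proof (intro ballI impI)
      fix i j assume "(inv \<pi> i, inv \<pi> j) \<in> G\<^sup>+"
      with \<open>?mono\<close> have "\<pi> (inv \<pi> i) < \<pi> (inv \<pi> j)" by blast
      then show "i < j" by (simp add: permutes_inverses[OF \<pi>])
    qed
  qed
  also have "\<dots> \<longleftrightarrow> (\<forall>a b. (a, b) \<in> G \<longrightarrow> \<pi> a < \<pi> b)"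
  proof
    assume *: "\<forall>a b. (a, b) \<in> G \<longrightarrow> \<pi> a < \<pi> b"
    have "\<pi> a < \<pi> b" if "(a, b) \<in> G\<^sup>+" for a b
      using that
    proof induction
      case (step b c)
      with * show ?case by (meson less_trans)
    qed (use * in blast)
    then show "\<forall>a b. (a, b) \<in> G\<^sup>+ \<longrightarrow> \<pi> a < \<pi> b" by blast
  qed blast
  also have "\<dots> \<longleftrightarrow> (\<forall>i\<in>{1..<n}. if up i then \<pi> i < \<pi> (next_rec R i) else \<pi> (next_rec R i) < \<pi> i)"
    unfolding G_def by (simp add: Ball_def) blast
  also have "\<dots> \<longleftrightarrow> (\<forall>i\<in>{1..<n}. i \<in> R \<longleftrightarrow> beats (\<epsilon> i) (\<pi> i) (\<pi> (next_rec R i)))"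
  proof (rule ball_cong[OF refl])
    fix i assume "i \<in> {1..<n}"
    with ne[of i] show "(if up i then \<pi> i < \<pi> (next_rec R i) else \<pi> (next_rec R i) < \<pi> i) \<longleftrightarrow>
        (i \<in> R \<longleftrightarrow> beats (\<epsilon> i) (\<pi> i) (\<pi> (next_rec R i)))"
      by (cases "\<epsilon> i") (auto simp: up_def beats_def)
  qed
  also have "\<dots> \<longleftrightarrow> Rec n \<epsilon> \<pi> = R" using Rec_eq_iff[OF assms(1-3)] by simp
  finally show ?thesis .
qed

lemma bij_betw_inv_lin_exts:
  assumes "n \<ge> 1" "R \<subseteq> {1..n}" "n \<in> R"
  shows "bij_betw inv {\<pi>. \<pi> permutes {1..n} \<and> Rec n \<epsilon> \<pi> = R} (lin_exts n (record_poset n \<epsilon> R))"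
    and "bij_betw inv (perms_with n \<epsilon> R k) (lin_exts_at n (record_poset n \<epsilon> R) k)"
proof -
  have inv_L: "inv \<sigma> permutes {1..n} \<and> Rec n \<epsilon> (inv \<sigma>) = R \<and> inv (inv \<sigma>) = \<sigma>"
    if "\<sigma> \<in> lin_exts n (record_poset n \<epsilon> R)" for \<sigma>
  proof -
    have \<sigma>: "\<sigma> permutes {1..n}" using that by (simp add: lin_exts_def)
    then show ?thesis
      using inv_in_lin_exts_iff[OF assms permutes_inv[OF \<sigma>]] that
      by (simp add: permutes_inv permutes_inv_inv)
  qed
  show "bij_betw inv {\<pi>. \<pi> permutes {1..n} \<and> Rec n \<epsilon> \<pi> = R} (lin_exts n (record_poset n \<epsilon> R))"
  proof (rule bij_betw_byWitness[where f' = inv])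
    show "inv ` {\<pi>. \<pi> permutes {1..n} \<and> Rec n \<epsilon> \<pi> = R} \<subseteq> lin_exts n (record_poset n \<epsilon> R)"
      using inv_in_lin_exts_iff[OF assms] by blast
  qed (use inv_L in \<open>auto simp: permutes_inv_inv\<close>)
  show "bij_betw inv (perms_with n \<epsilon> R k) (lin_exts_at n (record_poset n \<epsilon> R) k)"
  proof (rule bij_betw_byWitness[where f' = inv])
    show "inv ` perms_with n \<epsilon> R k \<subseteq> lin_exts_at n (record_poset n \<epsilon> R) k"
      using inv_in_lin_exts_iff[OF assms]
      by (fastforce simp: perms_with_def lin_exts_at_def permutes_inverses)
    show "inv ` lin_exts_at n (record_poset n \<epsilon> R) k \<subseteq> perms_with n \<epsilon> R k"
      using inv_L by (auto simp: perms_with_def lin_exts_at_def lin_exts_def permutes_inverses)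
  qed (use inv_L in \<open>auto simp: perms_with_def lin_exts_at_def permutes_inv_inv\<close>)
qed

section \<open>Decorated paths\<close>

context
  fixes n :: nat and \<epsilon> :: "nat \<Rightarrow> sign" and R :: "nat set" and w :: "sign list"
  assumes n: "n \<ge> 1" and R: "R \<subseteq> {1..n}" "n \<in> R" and w: "w = rev_word n \<epsilon>"
begin

text \<open>
  The inverse of \<open>path_perm n\<close>.  After \<open>i\<close> steps the positions \<open>n - i, \<dots>, n\<close>
  have been read, so the last record is the least element of \<open>R\<close> that is at least
  \<open>n - i\<close>, which is \<open>next_rec R (n - Suc i)\<close>.
\<close>

definition path_of :: "(nat \<Rightarrow> nat) \<Rightarrow> nat list \<times> (nat \<rightharpoonup> nat)" where
  "path_of \<pi> = (map (\<lambda>i. \<pi> (next_rec R (n - Suc i))) [0..<n],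
                \<lambda>i. if i \<in> {1..n-1} \<and> n - i \<notin> R then Some (\<pi> (n - i)) else None)"

lemma finite_R: "finite R"
  using R(1) finite_subset by blast

lemma length_w: "length w = n - 1"
  by (simp add: w)

lemma w_nth: "i \<in> {1..n-1} \<Longrightarrow> w ! (i - 1) = \<epsilon> (n - i)"
  by (auto simp: w rev_word_nth)

lemma next_rec_last: "next_rec R (n - Suc 0) = n"
  using next_rec_Suc_in[OF finite_R, of "n - 1"] n R(2) by simp

lemma next_rec_diff:
  assumes "i \<in> {1..n-1}"
  shows "next_rec R (n - Suc i) = (if n - i \<in> R then n - i else next_rec R (n - i))"
proof -
  have "n - i = Suc (n - Suc i)" using assms by auto
  then show ?thesis
    using next_rec_Suc_in[OF finite_R, of "n - Suc i"] next_rec_Suc_notin[of "n - Suc i" R] by auto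
qed

lemma reflect_image: "(\<lambda>i. n - i) ` {0..n-1} = {1..n}"
proof (intro equalityI subsetI)
  fix m assume "m \<in> {1..n}"
  then have "m = n - (n - m)" "n - m \<in> {0..n-1}" by auto
  then show "m \<in> (\<lambda>i. n - i) ` {0..n-1}" by blast
qed (use n in auto)

lemma path_perm_reflect:
  "i \<in> {0..n-1} \<Longrightarrow> path_perm n (g, \<theta>) (n - i) = (case \<theta> i of Some t \<Rightarrow> t | None \<Rightarrow> g ! i)"
proof -
  assume "i \<in> {0..n-1}"
  then have "i \<le> n" "n - i \<in> {1..n}" using n by auto
  then show ?thesis unfolding path_perm_def by (simp split: option.split)
qed

text \<open>
  The multiset condition on a path says that the values of the associated function exhaust
  \<open>{1..n}\<close>, which makes it a permutation.  By induction on the step, \<open>g ! i\<close> is the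
  value at the last record, so the inequalities that hold at jumps and flat steps become the local
  condition for \<open>R\<close>; the same description of \<open>g\<close> recovers the path.
\<close>

lemma path_perm_in_perms_with:
  assumes "(g, \<theta>) \<in> paths_with w k R"
  shows "path_perm n (g, \<theta>) \<in> perms_with n \<epsilon> R k"
    and "path_of (path_perm n (g, \<theta>)) = (g, \<theta>)"
proof -
  define \<pi> where "\<pi> = path_perm n (g, \<theta>)"
  define J E where "J = jumps w g" and "E = flat_steps w g"
  have r: "length w + 1 = n" "length w = n - 1" using n by (simp_all add: length_w)
  have path: "(g, \<theta>) \<in> paths w k" and JR: "(\<lambda>j. n - j) ` J = R - {n}"
    using assms unfolding paths_with_def Let_def r(1) J_def by auto
  have len: "length g = n" and g0: "g ! 0 = k"
    and mono: "\<And>i. i \<in> {1..n-1} \<Longrightarrow> (w ! (i - 1) = Plus \<longrightarrow> g ! i \<ge> g ! (i - 1)) \<and>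
                  (w ! (i - 1) = Minus \<longrightarrow> g ! i \<le> g ! (i - 1))"
    and dom: "dom \<theta> = E"
    and \<theta>: "\<And>i. i \<in> E \<Longrightarrow> (w ! (i - 1) = Plus \<longrightarrow> the (\<theta> i) < g ! (i - 1)) \<and>
             (w ! (i - 1) = Minus \<longrightarrow> the (\<theta> i) > g ! (i - 1))"
    and mset: "{#g ! 0#} + image_mset (\<lambda>i. g ! i) (mset_set J)
               + image_mset (\<lambda>i. the (\<theta> i)) (mset_set E) = mset_set {1..n}"
    using path n by (auto simp: paths_def Let_def r J_def E_def)
  have fin: "finite J" "finite E"
    by (simp_all add: J_def E_def jumps_def strict_plus_def strict_minus_def flat_steps_def)
  have JE: "J \<subseteq> {1..n-1}" "E = {1..n-1} - J"
  proof -
    show "J \<subseteq> {1..n-1}" by (auto simp: J_def jumps_def strict_plus_def strict_minus_def r)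
    have "i \<in> E \<longleftrightarrow> i \<notin> J" if "i \<in> {1..n-1}" for i
      using mono[OF that] that
      by (cases "w ! (i - 1)")
        (auto simp: J_def E_def jumps_def strict_plus_def strict_minus_def flat_steps_def r)
    moreover have "E \<subseteq> {1..n-1}" by (auto simp: E_def flat_steps_def r)
    ultimately show "E = {1..n-1} - J" by auto
  qed
  have J_iff: "i \<in> J \<longleftrightarrow> n - i \<in> R" if "i \<in> {1..n-1}" for i
  proof
    assume "n - i \<in> R"
    moreover have "n - i \<noteq> n" using that by auto
    ultimately have "n - i \<in> (\<lambda>j. n - j) ` J" unfolding JR by simp
    then obtain j where "j \<in> J" "n - i = n - j" by auto
    moreover from this JE(1) that have "i = j" by auto
    ultimately show "i \<in> J" by simp
  qed (use JR in auto)
  have \<pi>_E: "\<pi> (n - i) = the (\<theta> i)" if "i \<in> E" for i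
  proof -
    obtain t where "\<theta> i = Some t" using \<open>i \<in> E\<close> dom by blast
    then show ?thesis using path_perm_reflect[of i g \<theta>] \<open>i \<in> E\<close> JE by (auto simp: \<pi>_def)
  qed
  have \<pi>_g: "\<pi> (n - i) = g ! i" if "i \<in> {0..n-1}" "i \<notin> E" for i
    using that dom path_perm_reflect[OF that(1), of g \<theta>] by (auto simp: \<pi>_def split: option.split)
  have image: "\<pi> ` {1..n} = {1..n}"
  proof -
    have "{0..n-1} = insert 0 (J \<union> E)" using JE by auto
    then have "\<pi> ` {1..n} = insert (\<pi> (n - 0)) ((\<lambda>i. \<pi> (n - i)) ` J \<union> (\<lambda>i. \<pi> (n - i)) ` E)"
      by (simp only: reflect_image[symmetric] image_image image_insert image_Un)
    also have "\<pi> (n - 0) = g ! 0" using JE by (intro \<pi>_g) auto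
    also have "(\<lambda>i. \<pi> (n - i)) ` J = (\<lambda>i. g ! i) ` J"
      using JE by (intro image_cong refl \<pi>_g) auto
    also have "(\<lambda>i. \<pi> (n - i)) ` E = (\<lambda>i. the (\<theta> i)) ` E"
      by (intro image_cong refl \<pi>_E)
    also have "insert (g ! 0) ((\<lambda>i. g ! i) ` J \<union> (\<lambda>i. the (\<theta> i)) ` E) = {1..n}"
      using arg_cong[OF mset, of set_mset] fin by simp
    finally show ?thesis .
  qed
  have perm: "\<pi> permutes {1..n}"
  proof (rule bij_imp_permutes)
    show "bij_betw \<pi> {1..n} {1..n}"
      using image by (simp add: bij_betw_def eq_card_imp_inj_on)
  qed (auto simp: \<pi>_def path_perm_def)
  have g: "g ! i = \<pi> (next_rec R (n - Suc i))" if "i < n" for i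
    using that
  proof (induction i)
    case 0
    have "\<pi> (n - 0) = g ! 0" using JE by (intro \<pi>_g) auto
    then show ?case by (simp add: next_rec_last)
  next
    case (Suc i)
    then have i: "Suc i \<in> {1..n-1}" by auto
    show ?case
    proof (cases "Suc i \<in> J")
      case True
      then show ?thesis
        using J_iff[OF i] \<pi>_g[of "Suc i"] next_rec_diff[OF i] i JE by auto
    next
      case False
      then have "Suc i \<in> E" using JE i by simp
      then have "g ! Suc i = g ! i" by (simp add: E_def flat_steps_def)
      with False Suc show ?thesis using J_iff[OF i] next_rec_diff[OF i] by auto
    qed
  qed
  have "Rec n \<epsilon> \<pi> = R"
    unfolding Rec_eq_iff[OF n R]
  proof
    fix m assume m: "m \<in> {1..<n}"
    define i where "i = n - m"
    have i: "i \<in> {1..n-1}" and m_eq: "m = n - i" using m by (auto simp: i_def)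
    have prev: "\<pi> (next_rec R m) = g ! (i - 1)"
      using g[of "i - 1"] i by (auto simp: m_eq)
    show "m \<in> R \<longleftrightarrow> beats (\<epsilon> m) (\<pi> m) (\<pi> (next_rec R m))"
    proof (cases "i \<in> J")
      case True
      then have "\<pi> m = g ! i" using \<pi>_g[of i] i JE by (auto simp: m_eq)
      with True show ?thesis unfolding prev using J_iff[OF i] w_nth[OF i]
        by (auto simp: m_eq beats_def J_def jumps_def strict_plus_def strict_minus_def)
    next
      case False
      then have "i \<in> E" using JE i by simp
      from \<pi>_E[OF this] \<theta>[OF this] False show ?thesis
        unfolding prev using J_iff[OF i] w_nth[OF i]
        by (cases "\<epsilon> m") (auto simp: m_eq beats_def)
    qed
  qed
  moreover have "\<pi> n = k" using \<pi>_g[of 0] JE g0 by auto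
  ultimately show "path_perm n (g, \<theta>) \<in> perms_with n \<epsilon> R k"
    using perm by (simp add: perms_with_def \<pi>_def)
  have "map (\<lambda>i. \<pi> (next_rec R (n - Suc i))) [0..<n] = g"
    using g len by (intro nth_equalityI) auto
  moreover have "(if i \<in> {1..n-1} \<and> n - i \<notin> R then Some (\<pi> (n - i)) else None) = \<theta> i" for i
  proof (cases "i \<in> E")
    case True
    then obtain t where "\<theta> i = Some t" using dom by blast
    then show ?thesis using True J_iff[of i] JE \<pi>_E[of i] by auto
  next
    case False
    then have "\<theta> i = None" using dom by blast
    then show ?thesis using False J_iff[of i] JE by auto
  qed
  ultimately show "path_of (path_perm n (g, \<theta>)) = (g, \<theta>)"
    unfolding path_of_def \<pi>_def by presburger
qed

text \<open>
  Conversely, the local condition says that the path jumps precisely at the positions in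
  \<open>R\<close>; the strict inequalities for decorations need that \<open>\<pi>\<close> is injective.
\<close>

lemma path_of_in_paths_with:
  assumes "\<pi> \<in> perms_with n \<epsilon> R k"
  shows "path_of \<pi> \<in> paths_with w k R"
    and "path_perm n (path_of \<pi>) = \<pi>"
proof -
  have \<pi>: "\<pi> permutes {1..n}" and Rec: "Rec n \<epsilon> \<pi> = R" and k: "\<pi> n = k"
    using assms by (auto simp: perms_with_def)
  have r: "length w + 1 = n" "length w = n - 1" using n by (simp_all add: length_w)
  define g where "g = map (\<lambda>i. \<pi> (next_rec R (n - Suc i))) [0..<n]"
  define \<theta> where "\<theta> i = (if i \<in> {1..n-1} \<and> n - i \<notin> R then Some (\<pi> (n - i)) else None)" for i
  have path: "path_of \<pi> = (g, \<theta>)" by (simp add: path_of_def g_def \<theta>_def fun_eq_iff)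
  have len: "length g = n" by (simp add: g_def)
  have g: "g ! i = \<pi> (next_rec R (n - Suc i))" if "i < n" for i
    using that by (simp add: g_def)
  have g0: "g ! 0 = k" using g[of 0] n by (simp add: next_rec_last k)
  have prev: "g ! (i - 1) = \<pi> (next_rec R (n - i))" if "i \<in> {1..n-1}" for i
    using g[of "i - 1"] that by auto
  have step: "g ! i = (if n - i \<in> R then \<pi> (n - i) else g ! (i - 1))" if "i \<in> {1..n-1}" for i
    using g[of i] prev[OF that] next_rec_diff[OF that] that by auto
  have beats_iff: "n - i \<in> R \<longleftrightarrow> beats (\<epsilon> (n - i)) (\<pi> (n - i)) (g ! (i - 1))"
    if "i \<in> {1..n-1}" for i
    using Rec[unfolded Rec_eq_iff[OF n R]] prev[OF that] that by auto
  have ne: "\<pi> (n - i) \<noteq> g ! (i - 1)" if "i \<in> {1..n-1}" for i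
  proof -
    have "n - i < next_rec R (n - i)"
      using next_rec_in[OF finite_R R(2), of "n - i"] that by auto
    then show ?thesis
      unfolding prev[OF that] by (simp add: inj_eq[OF permutes_inj[OF \<pi>]])
  qed
  have cmp: "if n - i \<in> R then (case \<epsilon> (n - i) of Plus \<Rightarrow> \<pi> (n - i) > g ! (i - 1) | Minus \<Rightarrow> \<pi> (n - i) < g ! (i - 1))
      else (case \<epsilon> (n - i) of Plus \<Rightarrow> \<pi> (n - i) < g ! (i - 1) | Minus \<Rightarrow> \<pi> (n - i) > g ! (i - 1))"
    if "i \<in> {1..n-1}" for i
    using beats_iff[OF that] ne[OF that] by (auto simp: beats_def split: sign.splits)
  have J: "jumps w g = {i \<in> {1..n-1}. n - i \<in> R}"
  proof -
    have "(w ! (i - 1) = Plus \<and> g ! i > g ! (i - 1) \<or> w ! (i - 1) = Minus \<and> g ! i < g ! (i - 1))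
        \<longleftrightarrow> n - i \<in> R" if "i \<in> {1..n-1}" for i
      using cmp[OF that] step[OF that] w_nth[OF that] by (cases "\<epsilon> (n - i)") (auto split: if_splits)
    then show ?thesis by (auto simp: jumps_def strict_plus_def strict_minus_def r)
  qed
  have E: "flat_steps w g = {i \<in> {1..n-1}. n - i \<notin> R}"
  proof -
    have "g ! i = g ! (i - 1) \<longleftrightarrow> n - i \<notin> R" if "i \<in> {1..n-1}" for i
      using step[OF that] ne[OF that] by auto
    then show ?thesis by (auto simp: flat_steps_def r)
  qed
  have in_range: "\<pi> m \<in> {1..n}" if "m \<in> {1..n}" for m
    using that permutes_in_image[OF \<pi>] by blast
  have g_range: "set g \<subseteq> {1..n}"
  proof
    fix x assume "x \<in> set g"
    then obtain i where i: "i < n" "x = \<pi> (next_rec R (n - Suc i))" by (auto simp: g_def)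
    then have "next_rec R (n - Suc i) \<in> R"
      using next_rec_in[OF finite_R R(2), of "n - Suc i"] by auto
    with R(1) have "next_rec R (n - Suc i) \<in> {1..n}" by blast
    then show "x \<in> {1..n}" unfolding i(2) by (rule in_range)
  qed
  have mset: "{#g ! 0#} + image_mset (\<lambda>i. g ! i) (mset_set (jumps w g))
               + image_mset (\<lambda>i. the (\<theta> i)) (mset_set (flat_steps w g)) = mset_set {1..n}"
  proof -
    have split: "{0..n-1} = {0} \<union> jumps w g \<union> flat_steps w g" by (auto simp: J E)
    have fin: "finite (jumps w g)" "finite (flat_steps w g)" by (simp_all add: J E)
    have inj: "inj_on (\<lambda>i. \<pi> (n - i)) {0..n-1}"
    proof (rule inj_onI)
      fix i j assume "i \<in> {0..n-1}" "j \<in> {0..n-1}" "\<pi> (n - i) = \<pi> (n - j)"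
      then show "i = j" using n by (auto simp: inj_eq[OF permutes_inj[OF \<pi>]])
    qed
    have "mset_set {1..n} = mset_set ((\<lambda>i. \<pi> (n - i)) ` {0..n-1})"
      using permutes_image[OF \<pi>] reflect_image by (simp add: image_image[of \<pi> "\<lambda>i. n - i", symmetric])
    also have "\<dots> = image_mset (\<lambda>i. \<pi> (n - i)) (mset_set {0..n-1})"
      by (rule image_mset_mset_set[OF inj, symmetric])
    also have "mset_set {0..n-1} = {#0#} + mset_set (jumps w g) + mset_set (flat_steps w g)"
      unfolding split using fin by (subst mset_set_Union; auto simp: J E mset_set_Union)
    also have "image_mset (\<lambda>i. \<pi> (n - i)) \<dots> = {#\<pi> n#} + image_mset (\<lambda>i. \<pi> (n - i)) (mset_set (jumps w g))
        + image_mset (\<lambda>i. \<pi> (n - i)) (mset_set (flat_steps w g))"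
      by simp
    also have "image_mset (\<lambda>i. \<pi> (n - i)) (mset_set (jumps w g)) =
        image_mset (\<lambda>i. g ! i) (mset_set (jumps w g))"
      by (rule image_mset_cong) (use fin step in \<open>auto simp: J\<close>)
    also have "image_mset (\<lambda>i. \<pi> (n - i)) (mset_set (flat_steps w g)) =
        image_mset (\<lambda>i. the (\<theta> i)) (mset_set (flat_steps w g))"
      by (rule image_mset_cong) (use fin in \<open>auto simp: E \<theta>_def\<close>)
    finally show ?thesis by (simp add: g0 k)
  qed
  have "(g, \<theta>) \<in> paths w k"
    unfolding paths_def mem_Collect_eq prod.case Let_def r(1) unfolding r(2)
  proof (intro conjI)
    show "\<forall>i\<in>{1..n-1}. (w ! (i - 1) = Plus \<longrightarrow> g ! i \<ge> g ! (i - 1)) \<and>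
                  (w ! (i - 1) = Minus \<longrightarrow> g ! i \<le> g ! (i - 1))"
    proof
      fix i assume i: "i \<in> {1..n-1}"
      show "(w ! (i - 1) = Plus \<longrightarrow> g ! i \<ge> g ! (i - 1)) \<and>
                  (w ! (i - 1) = Minus \<longrightarrow> g ! i \<le> g ! (i - 1))"
        using cmp[OF i] step[OF i] w_nth[OF i] by (cases "\<epsilon> (n - i)") (auto split: if_splits)
    qed
    show "dom \<theta> = flat_steps w g" by (auto simp: E \<theta>_def dom_def)
    show "\<forall>i\<in>flat_steps w g. the (\<theta> i) \<in> {1..n} \<and>
             (w ! (i - 1) = Plus \<longrightarrow> the (\<theta> i) < g ! (i - 1)) \<and>
             (w ! (i - 1) = Minus \<longrightarrow> the (\<theta> i) > g ! (i - 1))"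
    proof
      fix i assume "i \<in> flat_steps w g"
      then have i: "i \<in> {1..n-1}" and nR: "n - i \<notin> R" by (auto simp: E)
      then have "\<theta> i = Some (\<pi> (n - i))" "n - i \<in> {1..n}" by (auto simp: \<theta>_def)
      then show "the (\<theta> i) \<in> {1..n} \<and>
             (w ! (i - 1) = Plus \<longrightarrow> the (\<theta> i) < g ! (i - 1)) \<and>
             (w ! (i - 1) = Minus \<longrightarrow> the (\<theta> i) > g ! (i - 1))"
        using cmp[OF i] nR w_nth[OF i] in_range[of "n - i"] by auto
    qed
    show "set g \<subseteq> {1..n}" by (rule g_range)
    show "g ! 0 = k" by (rule g0)
    show "length g = n" by (rule len)
  qed (rule mset)
  moreover have "(\<lambda>j. n - j) ` jumps w g = R - {n}"
  proof (intro equalityI subsetI)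
    fix m assume "m \<in> R - {n}"
    then have "m \<in> {1..n}" "m \<in> R" "m \<noteq> n" using R(1) by auto
    then have "m = n - (n - m)" "n - m \<in> jumps w g" by (auto simp: J)
    then show "m \<in> (\<lambda>j. n - j) ` jumps w g" by blast
  qed (auto simp: J)
  ultimately show "path_of \<pi> \<in> paths_with w k R"
    unfolding paths_with_def Let_def r(1) path by simp
  show "path_perm n (path_of \<pi>) = \<pi>"
  proof
    fix m
    show "path_perm n (path_of \<pi>) m = \<pi> m"
    proof (cases "m \<in> {1..n}")
      case True
      then have "Suc (n - Suc (n - m)) = m" "n - m < n" "n - (n - m) = m" by auto
      moreover have "m \<in> R" if "n - m \<notin> {1..n-1}"
      proof -
        have "m = n" using that True by auto
        then show ?thesis using R(2) by simp
      qed
      ultimately show ?thesis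
        using True g[of "n - m"] next_rec_Suc_in[OF finite_R, of "n - Suc (n - m)"]
        by (auto simp: path path_perm_def \<theta>_def)
    next
      case False
      then show ?thesis using permutes_not_in[OF \<pi> False] by (auto simp: path_perm_def path)
    qed
  qed
qed

lemma bij_betw_path_perm: "bij_betw (path_perm n) (paths_with w k R) (perms_with n \<epsilon> R k)"
  by (rule bij_betw_byWitness[where f' = path_of])
    (use path_perm_in_perms_with path_of_in_paths_with in auto)

end


section \<open>The generating function of the greedy records\<close>

definition rec_weight :: "(nat \<Rightarrow> sign) \<Rightarrow> nat \<Rightarrow> coeffs" where
  "rec_weight \<epsilon> i = (case \<epsilon> i of Plus \<Rightarrow> p_var | Minus \<Rightarrow> q_var) * y_var i"

lemma prod_rec_weight:
  assumes "A \<subseteq> {1..n-1}"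
  shows "(\<Prod>i\<in>A. rec_weight \<epsilon> i) =
    p_var ^ card (Rsub Plus n \<epsilon> A) * q_var ^ card (Rsub Minus n \<epsilon> A) * y_mon A"
proof -
  have fin: "finite A" using assms finite_subset by blast
  have eq: "Rsub s n \<epsilon> A = {i \<in> A. \<epsilon> i = s}" for s
    using assms by (auto simp: Rsub_def)
  have "(\<Prod>i\<in>A. case \<epsilon> i of Plus \<Rightarrow> p_var | Minus \<Rightarrow> q_var) =
      (\<Prod>i\<in>A. (if \<epsilon> i = Plus then p_var else 1) * (if \<epsilon> i = Minus then q_var else 1))"
  proof (intro prod.cong refl)
    fix i show "(case \<epsilon> i of Plus \<Rightarrow> p_var | Minus \<Rightarrow> q_var) =
        (if \<epsilon> i = Plus then p_var else 1) * (if \<epsilon> i = Minus then q_var else 1)"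
      by (cases "\<epsilon> i") simp_all
  qed
  also have "\<dots> = p_var ^ card {i \<in> A. \<epsilon> i = Plus} * q_var ^ card {i \<in> A. \<epsilon> i = Minus}"
    using fin by (simp add: prod.distrib prod.inter_filter[symmetric])
  finally show ?thesis
    by (simp add: rec_weight_def prod.distrib eq y_mon_def)
qed

text \<open>
  Arrangements of an arbitrary finite set of values are used instead of permutations of
  \<open>{1..m}\<close>, so that removing a value needs no relabelling of the others.
\<close>

definition arrangement_sum :: "(nat \<Rightarrow> sign) \<Rightarrow> nat set \<Rightarrow> nat \<Rightarrow> coeffs" where
  "arrangement_sum \<epsilon> S a = (\<Sum>xs\<in>permutations_of_set S. \<Prod>i\<in>scan \<epsilon> a xs. rec_weight \<epsilon> i)"

lemma arrangement_sum_empty [simp]: "arrangement_sum \<epsilon> {} a = 1"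
  by (simp add: arrangement_sum_def)

lemma arrangement_sum_rec:
  assumes "finite S" "S \<noteq> {}"
  shows "arrangement_sum \<epsilon> S a = (\<Sum>b\<in>S.
    if beats (\<epsilon> (card S)) b a then rec_weight \<epsilon> (card S) * arrangement_sum \<epsilon> (S - {b}) b
    else arrangement_sum \<epsilon> (S - {b}) a)"
proof -
  let ?f = "\<lambda>xs. \<Prod>i\<in>scan \<epsilon> a xs. rec_weight \<epsilon> i"
  have "arrangement_sum \<epsilon> S a = (\<Sum>b\<in>S. \<Sum>xs\<in>(#) b ` permutations_of_set (S - {b}). ?f xs)"
    unfolding arrangement_sum_def permutations_of_set_nonempty[OF assms(2)]
    by (rule sum.UNION_disjoint) (use assms in auto)
  also have "\<dots> = (\<Sum>b\<in>S. \<Sum>xs\<in>permutations_of_set (S - {b}). ?f (b # xs))"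
    by (simp add: sum.reindex)
  also have "\<dots> = (\<Sum>b\<in>S. if beats (\<epsilon> (card S)) b a
      then rec_weight \<epsilon> (card S) * arrangement_sum \<epsilon> (S - {b}) b
      else arrangement_sum \<epsilon> (S - {b}) a)"
  proof (intro sum.cong refl)
    fix b assume "b \<in> S"
    with assms(1) have "Suc (card (S - {b})) = card S" by (rule card_Suc_Diff1)
    then have len: "Suc (length xs) = card S" if "xs \<in> permutations_of_set (S - {b})" for xs
      using that by (simp add: length_finite_permutations_of_set)
    have new: "Suc (length xs) \<notin> scan \<epsilon> b xs" for xs
      by (auto dest!: subsetD[OF scan_subset])
    show "(\<Sum>xs\<in>permutations_of_set (S - {b}). ?f (b # xs)) = (if beats (\<epsilon> (card S)) b a
      then rec_weight \<epsilon> (card S) * arrangement_sum \<epsilon> (S - {b}) b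
      else arrangement_sum \<epsilon> (S - {b}) a)"
      by (auto simp: arrangement_sum_def sum_distrib_left len[symmetric] new intro!: sum.cong
          simp del: len)
  qed
  finally show ?thesis .
qed

text \<open>
  \<open>endpoint_sum \<epsilon> m j\<close> is the value of \<open>arrangement_sum\<close> for \<open>m\<close> values
  of which \<open>j\<close> lie below the current record.  The first summand covers the next value not
  becoming a record: there are \<open>j\<close> or \<open>m + 1 - j\<close> such values, and the current record
  is kept.  The second sums over the rank of the new record.
\<close>

fun endpoint_sum :: "(nat \<Rightarrow> sign) \<Rightarrow> nat \<Rightarrow> nat \<Rightarrow> coeffs" where
  "endpoint_sum \<epsilon> 0 j = 1"
| "endpoint_sum \<epsilon> (Suc m) j = (case \<epsilon> (Suc m) of
     Plus \<Rightarrow> of_nat j * endpoint_sum \<epsilon> m (j - 1)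
       + rec_weight \<epsilon> (Suc m) * (\<Sum>i\<in>{j..m}. endpoint_sum \<epsilon> m i)
   | Minus \<Rightarrow> of_nat (Suc m - j) * endpoint_sum \<epsilon> m j
       + rec_weight \<epsilon> (Suc m) * (\<Sum>i<j. endpoint_sum \<epsilon> m i))"

definition rank_in :: "nat set \<Rightarrow> nat \<Rightarrow> nat" where
  "rank_in S a = card {s \<in> S. s < a}"

lemma rank_in_mono: "finite S \<Longrightarrow> a \<le> b \<Longrightarrow> rank_in S a \<le> rank_in S b"
  unfolding rank_in_def by (rule card_mono) auto

lemma rank_in_less: "finite S \<Longrightarrow> b \<in> S \<Longrightarrow> b < a \<Longrightarrow> rank_in S b < rank_in S a"
  unfolding rank_in_def by (rule psubset_card_mono) auto

lemma rank_in_remove: "finite S \<Longrightarrow> b \<in> S \<Longrightarrow>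
    rank_in (S - {b}) a = (if b < a then rank_in S a - 1 else rank_in S a)"
proof -
  assume S: "finite S" "b \<in> S"
  have "{s \<in> S - {b}. s < a} = {s \<in> S. s < a} - {b}" by auto
  with S show ?thesis by (simp add: rank_in_def)
qed

lemma bij_betw_rank_in: 
  assumes "finite S"
  shows "bij_betw (rank_in S) S {..<card S}"
proof -
  have inj: "inj_on (rank_in S) S"
    by (rule linorder_inj_onI') (use rank_in_less[OF assms] in \<open>auto simp: less_imp_neq\<close>)
  have "rank_in S b < card S" if "b \<in> S" for b
    unfolding rank_in_def by (rule psubset_card_mono) (use assms that in auto)
  then have "rank_in S ` S \<subseteq> {..<card S}" by auto
  then have "rank_in S ` S = {..<card S}"
    by (rule card_subset_eq[rotated]) (simp_all add: card_image[OF inj])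
  with inj show ?thesis by (simp add: bij_betw_def)
qed

lemma rank_in_less_iff:
  assumes "finite S" "b \<in> S"
  shows "rank_in S b < rank_in S a \<longleftrightarrow> b < a"
  using rank_in_less[OF assms] rank_in_mono[OF assms(1), of a b] by (meson leD not_le_imp_less)

text \<open>
  Each rank is taken exactly once on \<open>S\<close>, the elements below \<open>a\<close> having the ranks
  below that of \<open>a\<close>.  This turns sums over the new record into sums over its rank.
\<close>

lemma sum_rank_in:
  assumes "finite S"
  shows "(\<Sum>b | b \<in> S \<and> b < a. f (rank_in S b)) = (\<Sum>i<rank_in S a. f i)"
    and "a \<notin> S \<Longrightarrow> (\<Sum>b | b \<in> S \<and> a < b. f (rank_in S b)) = (\<Sum>i=rank_in S a..<card S. f i)"
proof -
  note bij = bij_betw_rank_in[OF assms]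
  have inj: "inj_on (rank_in S) A" if "A \<subseteq> S" for A
    using bij that by (auto simp: bij_betw_def intro: inj_on_subset)
  have S: "(\<exists>b\<in>S. i = rank_in S b) \<longleftrightarrow> i < card S" for i
    using bij by (auto simp: bij_betw_def)
  have le: "rank_in S a \<le> card S" unfolding rank_in_def by (rule card_mono) (use assms in auto)
  have "rank_in S ` {b \<in> S. b < a} = {..<rank_in S a}"
  proof (intro equalityI subsetI)
    fix i assume i: "i \<in> {..<rank_in S a}"
    with S[of i] le obtain b where "b \<in> S" "i = rank_in S b" by auto
    with i rank_in_less_iff[OF assms, of b a] show "i \<in> rank_in S ` {b \<in> S. b < a}" by auto
  qed (auto simp: rank_in_less_iff[OF assms])
  then show "(\<Sum>b | b \<in> S \<and> b < a. f (rank_in S b)) = (\<Sum>i<rank_in S a. f i)"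
    by (intro sum.reindex_cong[OF inj, symmetric]) auto
  assume a: "a \<notin> S"
  have iff: "rank_in S a \<le> rank_in S b \<longleftrightarrow> a < b" if "b \<in> S" for b
    using rank_in_less_iff[OF assms that, of a] a that by (metis not_less not_less_iff_gr_or_eq)
  have "rank_in S ` {b \<in> S. a < b} = {rank_in S a..<card S}"
  proof (intro equalityI subsetI)
    fix i assume i: "i \<in> {rank_in S a..<card S}"
    with S[of i] obtain b where "b \<in> S" "i = rank_in S b" by auto
    with i iff[of b] show "i \<in> rank_in S ` {b \<in> S. a < b}" by auto
  qed (use iff S in auto)
  then show "(\<Sum>b | b \<in> S \<and> a < b. f (rank_in S b)) = (\<Sum>i=rank_in S a..<card S. f i)"
    by (intro sum.reindex_cong[OF inj, symmetric]) auto
qed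

text \<open>
  When the first value read is \<open>b\<close>, the remaining set is \<open>S - {b}\<close>.  A new record
  \<open>b\<close> has the same rank there as in \<open>S\<close>; an old record \<open>a\<close> loses one from its
  rank if \<open>b < a\<close> and keeps it otherwise.
\<close>

lemma arrangement_sum_eq_endpoint_sum:
  assumes "finite S" "a \<notin> S"
  shows "arrangement_sum \<epsilon> S a = endpoint_sum \<epsilon> (card S) (rank_in S a)"
  using assms
proof (induction "card S" arbitrary: S a)
  case 0
  then show ?case by simp
next
  case (Suc m S a)
  note fin = \<open>finite S\<close> and a = \<open>a \<notin> S\<close> and card = \<open>Suc m = card S\<close>[symmetric]
  let ?j = "rank_in S a" and ?w = "rec_weight \<epsilon> (Suc m)" and ?F = "endpoint_sum \<epsilon> m"
  let ?lo = "{b. b \<in> S \<and> b < a}" and ?hi = "{b. b \<in> S \<and> a < b}"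
  have "b < a \<or> a < b" if "b \<in> S" for b using a that by (metis linorder_neqE_nat)
  then have S: "S = ?lo \<union> ?hi" "?lo \<inter> ?hi = {}" by auto
  have card_lo: "card ?lo = ?j" by (simp add: rank_in_def)
  have card_hi: "card ?hi = Suc m - ?j"
  proof -
    have "card S = card ?lo + card ?hi"
      using S fin by (subst S(1), subst card_Un_disjoint) auto
    then show ?thesis by (simp add: card card_lo)
  qed
  have IH: "arrangement_sum \<epsilon> (S - {b}) c = ?F (rank_in (S - {b}) c)"
    if "b \<in> S" "c \<notin> S - {b}" for b c
  proof -
    have "m = card (S - {b})" using that fin card by simp
    then show ?thesis using Suc(1)[of "S - {b}" c] fin that(2) by simp
  qed
  have keep_lo: "arrangement_sum \<epsilon> (S - {b}) a = ?F (?j - 1)" if "b \<in> ?lo" for b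
    using that a fin by (simp add: IH rank_in_remove)
  have keep_hi: "arrangement_sum \<epsilon> (S - {b}) a = ?F ?j" if "b \<in> ?hi" for b
    using that a fin by (simp add: IH rank_in_remove)
  have new: "arrangement_sum \<epsilon> (S - {b}) b = ?F (rank_in S b)" if "b \<in> S" for b
    using that fin by (simp add: IH rank_in_remove)
  have "S \<noteq> {}" using card by auto
  from arrangement_sum_rec[OF fin this, of \<epsilon> a]
  have "arrangement_sum \<epsilon> S a = (\<Sum>b\<in>?lo \<union> ?hi.
      if beats (\<epsilon> (Suc m)) b a then ?w * arrangement_sum \<epsilon> (S - {b}) b
      else arrangement_sum \<epsilon> (S - {b}) a)"
    by (simp only: card S(1)[symmetric])
  also have "\<dots> = (\<Sum>b\<in>?lo. if \<epsilon> (Suc m) = Minus then ?w * ?F (rank_in S b) else ?F (?j - 1))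
      + (\<Sum>b\<in>?hi. if \<epsilon> (Suc m) = Plus then ?w * ?F (rank_in S b) else ?F ?j)"
  proof -
    have lo: "(if beats (\<epsilon> (Suc m)) b a then ?w * arrangement_sum \<epsilon> (S - {b}) b
        else arrangement_sum \<epsilon> (S - {b}) a) =
        (if \<epsilon> (Suc m) = Minus then ?w * ?F (rank_in S b) else ?F (?j - 1))" if "b \<in> ?lo" for b
      using that new[of b] keep_lo[OF that] by (cases "\<epsilon> (Suc m)") (auto simp: beats_def)
    have hi: "(if beats (\<epsilon> (Suc m)) b a then ?w * arrangement_sum \<epsilon> (S - {b}) b
        else arrangement_sum \<epsilon> (S - {b}) a) =
        (if \<epsilon> (Suc m) = Plus then ?w * ?F (rank_in S b) else ?F ?j)" if "b \<in> ?hi" for b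
      using that new[of b] keep_hi[OF that] by (cases "\<epsilon> (Suc m)") (auto simp: beats_def)
    have "finite ?lo" "finite ?hi" using fin by auto
    from sum.union_disjoint[OF this S(2)] show ?thesis
      by (rule trans) (intro arg_cong2[where f = "(+)"] sum.cong refl lo hi)
  qed
  also have "\<dots> = endpoint_sum \<epsilon> (Suc m) ?j"
    using sum_rank_in(1)[OF fin, of ?F a] sum_rank_in(2)[OF fin a, of ?F]
    by (cases "\<epsilon> (Suc m)")
      (simp_all add: card_lo card_hi card sum_distrib_left[symmetric] atLeastLessThanSuc_atLeastAtMost)
  finally show ?case by (simp add: card)
qed

text \<open>
  A permutation with \<open>\<pi> n = k\<close> is an arrangement of the other values, and
  \<open>k - 1\<close> of these lie below \<open>k\<close>.
\<close>

lemma sum_perms_eq_endpoint_sum: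
  assumes "n \<ge> 1" "k \<in> {1..n}"
  shows "(\<Sum>\<pi> | \<pi> permutes {1..n} \<and> \<pi> n = k. \<Prod>i\<in>Rec n \<epsilon> \<pi> - {n}. rec_weight \<epsilon> i) =
    endpoint_sum \<epsilon> (n - 1) (k - 1)"
proof -
  let ?P = "{\<pi>. \<pi> permutes {1..n} \<and> \<pi> n = k}" and ?S = "{1..n} - {k}"
  \<comment> \<open>Recovers the permutation from its values at \<open>n - 1, \<dots>, 1\<close>.\<close>
  define unword where
    "unword xs m = (if m = n then k else if m \<in> {1..<n} then xs ! (n - 1 - m) else m)" for xs m
  have split: "{1..n} = insert n {1..<n}" using assms(1) by auto
  have set_word: "set (rev_word n f) = f ` {1..<n}" for f :: "nat \<Rightarrow> nat"
    by (simp add: rev_word_def)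
  have "bij_betw (rev_word n) ?P (permutations_of_set ?S)"
  proof (rule bij_betw_byWitness[where f' = unword])
    show "\<forall>\<pi>\<in>?P. unword (rev_word n \<pi>) = \<pi>"
    proof (intro ballI ext)
      fix \<pi> m assume "\<pi> \<in> ?P"
      then have \<pi>: "\<pi> permutes {1..n}" "\<pi> n = k" by auto
      consider "m = n" | "m \<in> {1..<n}" | "m \<notin> {1..n}" "m \<noteq> n" using split by blast
      then show "unword (rev_word n \<pi>) m = \<pi> m"
      proof cases
        case 2
        then have "n - 1 - m < n - 1" "n - 1 - (n - 1 - m) = m" by auto
        with 2 show ?thesis by (simp add: unword_def rev_word_nth)
      next
        case 3
        then show ?thesis using permutes_not_in[OF \<pi>(1) 3(1)] by (auto simp: unword_def)
      qed (simp add: unword_def \<pi>)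
    qed
    have len: "length xs = n - 1" if "xs \<in> permutations_of_set ?S" for xs
      using length_finite_permutations_of_set[OF that] assms by simp
    show word_unword: "\<forall>xs\<in>permutations_of_set ?S. rev_word n (unword xs) = xs"
    proof
      fix xs assume "xs \<in> permutations_of_set ?S"
      then show "rev_word n (unword xs) = xs"
      proof (intro nth_equalityI)
        fix i assume "i < length (rev_word n (unword xs))"
        then have i: "i < n - 1" by simp
        then have "n - 1 - i \<in> {1..<n}" "n - 1 - (n - 1 - i) = i" "n - 1 - i \<noteq> n" by auto
        then show "rev_word n (unword xs) ! i = xs ! i"
          unfolding rev_word_nth[OF i] unword_def by presburger
      qed (simp add: len)
    qed
    show "rev_word n ` ?P \<subseteq> permutations_of_set ?S"
    proof clarify
      fix \<pi> assume \<pi>: "\<pi> permutes {1..n}" "k = \<pi> n"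
      show "rev_word n \<pi> \<in> permutations_of_set ({1..n} - {\<pi> n})"
      proof (rule permutations_of_setI)
        show "distinct (rev_word n \<pi>)"
          by (simp add: rev_word_def distinct_map inj_on_subset[OF permutes_inj[OF \<pi>(1)]])
        have "\<pi> ` ({1..n} - {n}) = \<pi> ` {1..n} - \<pi> ` {n}"
          by (rule image_set_diff[OF permutes_inj[OF \<pi>(1)]])
        moreover have "{1..n} - {n} = {1..<n}" by auto
        ultimately show "set (rev_word n \<pi>) = {1..n} - {\<pi> n}"
          using permutes_image[OF \<pi>(1)] by (simp add: set_word)
      qed
    qed
    show "unword ` permutations_of_set ?S \<subseteq> ?P"
    proof clarify
      fix xs assume xs: "xs \<in> permutations_of_set ?S"
      have "unword xs ` {1..<n} = ?S"
      proof -
        have "rev_word n (unword xs) = xs" using word_unword xs by blast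
        with permutations_of_setD(1)[OF xs] set_word[of "unword xs"] show ?thesis by simp
      qed
      moreover have "unword xs n = k" by (simp add: unword_def)
      ultimately have "unword xs ` insert n {1..<n} = insert k ({1..n} - {k})"
        by (simp only: image_insert)
      also have "insert k ({1..n} - {k}) = {1..n}" using assms(2) by (rule insert_Diff)
      finally have image: "unword xs ` {1..n} = {1..n}" unfolding split .
      have "unword xs permutes {1..n}"
      proof (rule bij_imp_permutes)
        show "bij_betw (unword xs) {1..n} {1..n}"
          using image by (simp add: bij_betw_def eq_card_imp_inj_on)
        show "unword xs m = m" if "m \<notin> {1..n}" for m
          using that assms(1) by (auto simp: unword_def)
      qed
      then show "unword xs permutes {1..n} \<and> unword xs n = k" by (simp add: unword_def)
    qed
  qed
  then have "arrangement_sum \<epsilon> ?S k =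
      (\<Sum>\<pi>\<in>?P. \<Prod>i\<in>scan \<epsilon> k (rev_word n \<pi>). rec_weight \<epsilon> i)"
    unfolding arrangement_sum_def by (rule sum.reindex_bij_betw[symmetric])
  also have "\<dots> = (\<Sum>\<pi>\<in>?P. \<Prod>i\<in>Rec n \<epsilon> \<pi> - {n}. rec_weight \<epsilon> i)"
  proof (intro sum.cong refl prod.cong)
    fix \<pi> assume "\<pi> \<in> ?P"
    moreover have "n \<notin> scan \<epsilon> k (rev_word n \<pi>)"
      using assms(1) by (auto dest!: subsetD[OF scan_subset])
    ultimately show "scan \<epsilon> k (rev_word n \<pi>) = Rec n \<epsilon> \<pi> - {n}"
      by (auto simp: Rec_eq_scan[OF assms(1)])
  qed
  finally have "(\<Sum>\<pi>\<in>?P. \<Prod>i\<in>Rec n \<epsilon> \<pi> - {n}. rec_weight \<epsilon> i) = arrangement_sum \<epsilon> ?S k" ..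
  also have "\<dots> = endpoint_sum \<epsilon> (card ?S) (rank_in ?S k)"
    by (rule arrangement_sum_eq_endpoint_sum) auto
  also have "{s \<in> ?S. s < k} = {1..<k}" using assms(2) by auto
  then have "rank_in ?S k = k - 1" by (simp add: rank_in_def)
  also have "card ?S = n - 1" using assms(2) by simp
  finally show ?thesis .
qed

section \<open>Formal integrals of Bernstein polynomials\<close>

lemma coeff_antideriv:
  "coeff (antideriv f) i = (case i of 0 \<Rightarrow> 0 | Suc j \<Rightarrow> Const (1 / of_nat (Suc j)) * coeff f j)"
proof (cases i)
  case 0
  then show ?thesis by (simp add: antideriv_def coeff_sum)
next
  case (Suc j)
  have "coeff (antideriv f) (Suc j) =
      (\<Sum>i\<le>degree f. if i = j then Const (1 / of_nat (Suc i)) * coeff f i else 0)"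
    unfolding antideriv_def coeff_sum coeff_monom by (intro sum.cong refl) simp
  also have "\<dots> = Const (1 / of_nat (Suc j)) * coeff f j"
    by (simp add: coeff_eq_0 del: of_nat_Suc)
  finally show ?thesis using Suc by simp
qed

lemma antideriv_add: "antideriv (f + g) = antideriv f + antideriv g"
  by (rule poly_eqI) (simp add: coeff_antideriv distrib_left split: nat.split)

lemma antideriv_smult: "antideriv (smult c f) = smult c (antideriv f)"
  by (rule poly_eqI) (simp add: coeff_antideriv mult.left_commute split: nat.split)

lemma integ_add: "integ a b (f + g) = integ a b f + integ a b g"
  by (simp add: integ_def antideriv_add pcompose_add)

lemma integ_smult: "integ a b (smult c f) = smult c (integ a b f)"
  by (simp add: integ_def antideriv_smult pcompose_smult smult_diff_right)

lemma integ_0: "integ a b 0 = 0"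
  using integ_smult[of a b 0 0] by simp

lemma integ_sum: "integ a b (\<Sum>i\<in>A. f i) = (\<Sum>i\<in>A. integ a b (f i))"
  by (induction A rule: infinite_finite_induct) (simp_all add: integ_add integ_0)

text \<open>
  The fundamental theorem of calculus for formal polynomials: over an integral domain of
  characteristic zero a polynomial with derivative zero is constant, and constants cancel in the difference.
\<close>

lemma integ_pderiv: "integ a b (pderiv F) = pcompose F b - pcompose F a"
proof -
  have "pderiv (F - antideriv (pderiv F)) = 0" by (simp add: pderiv_diff pderiv_antideriv)
  then obtain c where "F - antideriv (pderiv F) = [:c:]" using pderiv_iszero by blast
  then have "F = antideriv (pderiv F) + [:c:]" by (simp add: algebra_simps)
  then have "pcompose F x = pcompose (antideriv (pderiv F)) x + [:c:]" for x
    by (metis pcompose_add pcompose_const)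
  then show ?thesis by (simp add: integ_def)
qed

lemma smult_of_nat: "smult (of_nat m) f = of_nat m * f"
  by (simp add: of_nat_poly)

lemma integ_of_nat_mult: "integ a b (of_nat k * f) = of_nat k * integ a b f"
  by (simp only: smult_of_nat[symmetric] integ_smult)

text \<open>
  The Bernstein basis with its index shifted to start at \<open>0\<close>, so that it is indexed by ranks
  and not by values.
\<close>

definition bern :: "nat \<Rightarrow> nat \<Rightarrow> coeffs poly" where
  "bern m i = Bern m (Suc i)"

lemma bern_eq: "bern m i = of_nat (m choose i) * X ^ i * (1 - X) ^ (m - i)"
  by (simp add: bern_def Bern_def)

lemma X_times_bern: "of_nat (Suc m) * (X * bern m i) = of_nat (Suc i) * bern (Suc m) (Suc i)"
proof -
  have "of_nat (Suc m) * of_nat (m choose i) = (of_nat (Suc i) * of_nat (Suc m choose Suc i) :: coeffs poly)"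
    unfolding of_nat_mult[symmetric] by (simp only: Suc_times_binomial)
  then show ?thesis by (simp add: bern_eq algebra_simps del: of_nat_Suc binomial_Suc_Suc)
qed

lemma one_minus_X_times_bern:
  "of_nat (Suc m) * ((1 - X) * bern m i) = of_nat (Suc m - i) * bern (Suc m) i"
proof (cases "i \<le> m")
  case True
  have "Suc m * (m choose i) = (Suc m - i) * (Suc m choose i)"
    using binomial_absorb_comp[of "Suc m" i] by simp
  then have "of_nat (Suc m) * of_nat (m choose i) =
      (of_nat (Suc m - i) * of_nat (Suc m choose i) :: coeffs poly)"
    unfolding of_nat_mult[symmetric] by (rule arg_cong)
  moreover have "(1 - X) ^ (Suc m - i) = (1 - X) * (1 - X) ^ (m - i)"
    using True by (simp add: Suc_diff_le)
  ultimately show ?thesis by (simp add: bern_eq mult.left_commute mult.assoc[symmetric] del: of_nat_Suc)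
next
  case False
  then show ?thesis by (simp add: bern_eq)
qed

lemma pderiv_one_minus_X_power: "pderiv ((1 - X) ^ k) = - (of_nat k * (1 - X) ^ (k - 1))"
  by (cases k)
    (simp_all add: pderiv_power_Suc pderiv_diff pderiv_pCons smult_of_nat one_pCons[symmetric]
      del: of_nat_Suc power_Suc)

lemma pderiv_bern_Suc: "pderiv (bern (Suc m) (Suc i)) = of_nat (Suc m) * (bern m i - bern m (Suc i))"
proof -
  have deriv: "pderiv (X ^ Suc i * (1 - X) ^ (m - i)) =
      of_nat (Suc i) * X ^ i * (1 - X) ^ (m - i) - of_nat (m - i) * X ^ Suc i * (1 - X) ^ (m - Suc i)"
  proof -
    have "pderiv (X ^ k) = of_nat k * X ^ (k - 1)" for k
      by (cases k) (simp_all add: pderiv_power_Suc pderiv_pCons smult_of_nat del: of_nat_Suc power_Suc)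
    then show ?thesis
      by (simp add: pderiv_mult pderiv_one_minus_X_power algebra_simps del: of_nat_Suc power_Suc)
  qed
  have up: "of_nat (Suc m choose Suc i) * of_nat (Suc i) = (of_nat (Suc m) * of_nat (m choose i) :: coeffs poly)"
    unfolding of_nat_mult[symmetric] by (simp only: Suc_times_binomial mult.commute)
  have "(Suc m choose Suc i) * (m - i) = Suc m * (m choose Suc i)"
    using binomial_absorb_comp[of "Suc m" "Suc i"] by (simp add: mult.commute)
  then have down: "of_nat (Suc m choose Suc i) * of_nat (m - i) =
      (of_nat (Suc m) * of_nat (m choose Suc i) :: coeffs poly)"
    unfolding of_nat_mult[symmetric] by (rule arg_cong)
  have "bern (Suc m) (Suc i) = smult (of_nat (Suc m choose Suc i)) (X ^ Suc i * (1 - X) ^ (m - i))"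
    by (simp add: bern_eq smult_of_nat mult.assoc del: binomial_Suc_Suc)
  then have "pderiv (bern (Suc m) (Suc i)) = smult (of_nat (Suc m choose Suc i))
      (of_nat (Suc i) * X ^ i * (1 - X) ^ (m - i) - of_nat (m - i) * X ^ Suc i * (1 - X) ^ (m - Suc i))"
    by (simp only: pderiv_smult deriv)
  also have "\<dots> =
      of_nat (Suc m choose Suc i) * of_nat (Suc i) * X ^ i * (1 - X) ^ (m - i) -
      of_nat (Suc m choose Suc i) * of_nat (m - i) * X ^ Suc i * (1 - X) ^ (m - Suc i)"
    unfolding smult_of_nat by (simp only: right_diff_distrib mult.assoc)
  also have "\<dots> = of_nat (Suc m) * (bern m i - bern m (Suc i))"
    unfolding up down bern_eq by (simp only: right_diff_distrib mult.assoc)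
  finally show ?thesis .
qed

text \<open>
  The derivative of a Bernstein polynomial is a difference of two consecutive ones of lower degree,
  so for partial sums it telescopes.
\<close>

lemma pderiv_sum_bern: "pderiv (\<Sum>j\<le>i. bern (Suc m) j) = - (of_nat (Suc m) * bern m i)"
proof (induction i)
  case 0
  have "bern (Suc m) 0 = (1 - X) ^ Suc m" "bern m 0 = (1 - X) ^ m" by (simp_all add: bern_eq)
  then show ?case using pderiv_one_minus_X_power[of "Suc m"] by simp
next
  case (Suc i)
  then show ?case by (simp add: pderiv_add pderiv_bern_Suc algebra_simps del: of_nat_Suc)
qed

lemma sum_bern: "(\<Sum>j\<le>m. bern m j) = 1"
  using binomial_ring[of X "1 - X" m] by (simp add: bern_eq)

lemma pcompose_power: "pcompose (f ^ k) a = pcompose (f :: coeffs poly) a ^ k"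
  by (induction k) (simp_all add: pcompose_mult pcompose_1)

lemma pcompose_of_nat: "pcompose (of_nat k) a = (of_nat k :: coeffs poly)"
  by (induction k) (simp_all add: pcompose_add pcompose_1)

lemma pcompose_bern: "pcompose (bern m j) a = of_nat (m choose j) * a ^ j * (1 - a) ^ (m - j)"
  by (simp add: bern_eq pcompose_mult pcompose_power pcompose_diff pcompose_pCons pcompose_1
      pcompose_of_nat)

lemma pcompose_sum_bern_0: "pcompose (\<Sum>j\<le>i. bern m j) 0 = 1"
proof -
  have "pcompose (\<Sum>j\<le>i. bern m j) 0 = (\<Sum>j\<le>i. if j = 0 then 1 else 0)"
    unfolding pcompose_sum pcompose_bern by (intro sum.cong refl) (simp add: power_0_left)
  then show ?thesis by simp
qed

lemma pcompose_sum_bern_1: "i < m \<Longrightarrow> pcompose (\<Sum>j\<le>i. bern m j) 1 = 0"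
  by (simp add: pcompose_sum pcompose_bern power_0_left)

text \<open>
  By \<open>pderiv_sum_bern\<close>, the negative of a partial sum is an antiderivative.  All integrals
  that occur below have limits in \<open>0\<close>, \<open>1\<close> and \<open>X\<close>, where a proper partial sum
  takes the values \<open>1\<close>, \<open>0\<close> and itself.
\<close>

lemma integ_bern:
  assumes "i \<le> m"
  shows "of_nat (Suc m) * integ a b (bern m i) =
    pcompose (\<Sum>j\<le>i. bern (Suc m) j) a - pcompose (\<Sum>j\<le>i. bern (Suc m) j) b"
proof -
  have "pderiv (- (\<Sum>j\<le>i. bern (Suc m) j)) = smult (of_nat (Suc m)) (bern m i)"
    by (simp only: pderiv_minus pderiv_sum_bern minus_minus smult_of_nat)
  from arg_cong[OF this, of "integ a b"]
  have "of_nat (Suc m) * integ a b (bern m i) =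
      - pcompose (\<Sum>j\<le>i. bern (Suc m) j) b - - pcompose (\<Sum>j\<le>i. bern (Suc m) j) a"
    by (simp only: integ_of_nat_mult integ_pderiv pcompose_uminus smult_of_nat)
  then show ?thesis
    by (simp only: diff_conv_add_uminus minus_minus add.commute)
qed

section \<open>The polynomials in the Bernstein basis\<close>

lemma smult_sum_right: "smult c (\<Sum>i\<in>A. f i) = (\<Sum>i\<in>A. smult c (f i))"
  by (induction A rule: infinite_finite_induct) (simp_all add: smult_add_right)

lemma smult_sum_swap:
  fixes f :: "nat \<Rightarrow> coeffs" and g :: "nat \<Rightarrow> coeffs poly"
  assumes "finite A" "finite B"
  shows "(\<Sum>i\<in>A. smult (f i) (\<Sum>j | j \<in> B \<and> P i j. g j)) =
    (\<Sum>j\<in>B. smult (\<Sum>i | i \<in> A \<and> P i j. f i) (g j))"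
  unfolding smult_sum smult_sum_right by (rule sum.swap_restrict[OF assms])

text \<open>
  The coefficients in the Bernstein basis satisfy the recurrence of \<open>endpoint_sum\<close>: the
  product with \<open>X\<close> or \<open>1 - X\<close> gives its first summand, and the integral of the
  \<open>i\<close>-th basis polynomial contributes to the coefficient of every \<open>j \<le> i\<close>
  (for \<open>Plus\<close>) or every \<open>j > i\<close> (for \<open>Minus\<close>), which after exchanging the sums
  is its second.
\<close>

lemma fact_K_eq_sum_bern:
  "fact m * K p_var q_var (rev_word (Suc m) \<epsilon>) (rev_word (Suc m) y_var) =
    (\<Sum>j\<le>m. smult (endpoint_sum \<epsilon> m j) (bern m j))"
proof (induction m)
  case 0
  show ?case by (simp add: bern_eq)
next
  case (Suc m)
  define Kv where "Kv = K p_var q_var (rev_word (Suc m) \<epsilon>) (rev_word (Suc m) y_var)"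
  let ?E = "endpoint_sum \<epsilon> m" and ?u = "rec_weight \<epsilon> (Suc m)"
  let ?N = "of_nat (Suc m) :: coeffs poly" and ?b = "bern (Suc m)"
  have IH: "fact m * Kv = (\<Sum>j\<le>m. smult (?E j) (bern m j))" using Suc by (simp add: Kv_def)
  have fact: "fact (Suc m) * f = ?N * (fact m * f)" for f :: "coeffs poly"
    by (simp add: algebra_simps)
  have mult: "fact (Suc m) * (x * Kv) = (\<Sum>j\<le>m. smult (?E j) (?N * (x * bern m j)))" for x
  proof -
    have "fact (Suc m) * (x * Kv) = ?N * (x * (fact m * Kv))"
      unfolding fact by (simp only: mult.left_commute)
    also have "\<dots> = (\<Sum>j\<le>m. smult (?E j) (?N * (x * bern m j)))"
      unfolding IH sum_distrib_left mult_smult_right ..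
    finally show ?thesis .
  qed
  have int: "fact (Suc m) * integ a b Kv = (\<Sum>i\<le>m. smult (?E i) (?N * integ a b (bern m i)))" for a b
  proof -
    have "fact m * integ a b Kv = integ a b (fact m * Kv)"
      using integ_of_nat_mult[of a b "fact m" Kv] by simp
    then have "fact (Suc m) * integ a b Kv = ?N * integ a b (\<Sum>j\<le>m. smult (?E j) (bern m j))"
      unfolding fact IH by simp
    also have "\<dots> = (\<Sum>i\<le>m. smult (?E i) (?N * integ a b (bern m i)))"
      unfolding integ_sum integ_smult sum_distrib_left mult_smult_right ..
    finally show ?thesis .
  qed
  show ?case
  proof (cases "\<epsilon> (Suc m)")
    case Plus
    have "fact (Suc m) * (X * Kv) = (\<Sum>j\<le>m. smult (of_nat (Suc j) * ?E j) (?b (Suc j)))"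
      unfolding mult X_times_bern unfolding smult_of_nat[symmetric] smult_smult
      by (simp only: mult.commute)
    also have "\<dots> = (\<Sum>j\<le>Suc m. smult (of_nat j * ?E (j - 1)) (?b j))"
      by (subst sum.atMost_Suc_shift) simp
    finally have flat: "fact (Suc m) * (X * Kv) = \<dots>" .
    have "fact (Suc m) * integ X 1 Kv = (\<Sum>i\<le>m. smult (?E i) (\<Sum>j | j \<in> {..Suc m} \<and> j \<le> i. ?b j))"
      unfolding int
    proof (intro sum.cong refl arg_cong[where f = "smult _"])
      fix i assume "i \<in> {..m}"
      then have "i \<le> m" "{j. j \<in> {..Suc m} \<and> j \<le> i} = {..i}" by auto
      then show "?N * integ X 1 (bern m i) = (\<Sum>j | j \<in> {..Suc m} \<and> j \<le> i. ?b j)"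
        by (simp only: integ_bern pcompose_idR pcompose_sum_bern_1 less_Suc_eq_le diff_0_right)
    qed
    also have "\<dots> = (\<Sum>j\<le>Suc m. smult (\<Sum>i | i \<in> {..m} \<and> j \<le> i. ?E i) (?b j))"
      by (rule smult_sum_swap) auto
    also have "\<dots> = (\<Sum>j\<le>Suc m. smult (\<Sum>i=j..m. ?E i) (?b j))"
      by (intro sum.cong refl arg_cong2[where f = smult]) auto
    finally have jump: "fact (Suc m) * integ X 1 Kv = \<dots>" .
    have "fact (Suc m) * K p_var q_var (rev_word (Suc (Suc m)) \<epsilon>) (rev_word (Suc (Suc m)) y_var) =
        fact (Suc m) * (X * Kv) + smult ?u (fact (Suc m) * integ X 1 Kv)"
      using Plus by (simp add: Kv_def rec_weight_def distrib_left del: fact_Suc)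
    also have "\<dots> = (\<Sum>j\<le>Suc m. smult (endpoint_sum \<epsilon> (Suc m) j) (?b j))"
      unfolding flat jump smult_sum_right sum.distrib[symmetric] using Plus by (simp add: smult_add_left)
    finally show ?thesis .
  next
    case Minus
    have "fact (Suc m) * ((1 - X) * Kv) = (\<Sum>j\<le>m. smult (of_nat (Suc m - j) * ?E j) (?b j))"
      unfolding mult one_minus_X_times_bern unfolding smult_of_nat[symmetric] smult_smult
      by (simp only: mult.commute)
    also have "\<dots> = (\<Sum>j\<le>Suc m. smult (of_nat (Suc m - j) * ?E j) (?b j))"
      by simp
    finally have flat: "fact (Suc m) * ((1 - X) * Kv) = \<dots>" .
    have "fact (Suc m) * integ 0 X Kv = (\<Sum>i\<le>m. smult (?E i) (\<Sum>j | j \<in> {..Suc m} \<and> i < j. ?b j))"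
      unfolding int
    proof (intro sum.cong refl arg_cong[where f = "smult _"])
      fix i assume "i \<in> {..m}"
      then have i: "i \<le> m" by simp
      have "(\<Sum>j\<le>i. ?b j) + (\<Sum>j | j \<in> {..Suc m} \<and> i < j. ?b j) =
          (\<Sum>j\<in>{..i} \<union> {j. j \<in> {..Suc m} \<and> i < j}. ?b j)"
        by (rule sum.union_disjoint[symmetric]) auto
      also have "{..i} \<union> {j. j \<in> {..Suc m} \<and> i < j} = {..Suc m}" using i by auto
      also have "(\<Sum>j\<le>Suc m. ?b j) = 1" by (rule sum_bern)
      finally have "(\<Sum>j | j \<in> {..Suc m} \<and> i < j. ?b j) = 1 - (\<Sum>j\<le>i. ?b j)"
        by (simp only: eq_diff_eq add.commute)
      then show "?N * integ 0 X (bern m i) = (\<Sum>j | j \<in> {..Suc m} \<and> i < j. ?b j)"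
        unfolding integ_bern[OF i] pcompose_idR pcompose_sum_bern_0 by simp
    qed
    also have "\<dots> = (\<Sum>j\<le>Suc m. smult (\<Sum>i | i \<in> {..m} \<and> i < j. ?E i) (?b j))"
      by (rule smult_sum_swap) auto
    also have "\<dots> = (\<Sum>j\<le>Suc m. smult (\<Sum>i<j. ?E i) (?b j))"
      by (intro sum.cong refl arg_cong2[where f = smult]) auto
    finally have jump: "fact (Suc m) * integ 0 X Kv = \<dots>" .
    have "fact (Suc m) * K p_var q_var (rev_word (Suc (Suc m)) \<epsilon>) (rev_word (Suc (Suc m)) y_var) =
        fact (Suc m) * ((1 - X) * Kv) + smult ?u (fact (Suc m) * integ 0 X Kv)"
      using Minus by (simp add: Kv_def rec_weight_def distrib_left del: fact_Suc)
    also have "\<dots> = (\<Sum>j\<le>Suc m. smult (endpoint_sum \<epsilon> (Suc m) j) (?b j))"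
      unfolding flat jump smult_sum_right sum.distrib[symmetric] using Minus by (simp add: smult_add_left)
    finally show ?thesis .
  qed
qed

lemma sum_constant_poly: "(\<Sum>i\<in>A. [:f i:]) = [:\<Sum>i\<in>A. f i:]"
  by (induction A rule: infinite_finite_induct) simp_all

lemma fact_integ_K:
  "smult (fact (Suc m)) (integ 0 1 (K p_var q_var (rev_word (Suc m) \<epsilon>) (rev_word (Suc m) y_var))) =
    [:\<Sum>j\<le>m. endpoint_sum \<epsilon> m j:]"
proof -
  let ?K = "K p_var q_var (rev_word (Suc m) \<epsilon>) (rev_word (Suc m) y_var)"
  have "smult (fact (Suc m)) (integ 0 1 ?K) = smult (of_nat (Suc m)) (smult (of_nat (fact m)) (integ 0 1 ?K))"
    by simp
  also have "\<dots> = of_nat (Suc m) * integ 0 1 (fact m * ?K)"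
    using integ_of_nat_mult[of 0 1 "fact m" ?K] unfolding smult_of_nat by (simp only: of_nat_fact)
  also have "\<dots> = (\<Sum>j\<le>m. smult (endpoint_sum \<epsilon> m j) (of_nat (Suc m) * integ 0 1 (bern m j)))"
    unfolding fact_K_eq_sum_bern integ_sum integ_smult sum_distrib_left mult_smult_right ..
  also have "\<dots> = (\<Sum>j\<le>m. [:endpoint_sum \<epsilon> m j:])"
  proof (intro sum.cong refl)
    fix j assume "j \<in> {..m}"
    then have "of_nat (Suc m) * integ 0 1 (bern m j) = 1"
      using integ_bern[of j m 0 1] pcompose_sum_bern_0[of "Suc m" j] pcompose_sum_bern_1[of j "Suc m"]
      by simp
    then show "smult (endpoint_sum \<epsilon> m j) (of_nat (Suc m) * integ 0 1 (bern m j)) = [:endpoint_sum \<epsilon> m j:]"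
      by simp
  qed
  also have "\<dots> = [:\<Sum>j\<le>m. endpoint_sum \<epsilon> m j:]"
    by (rule sum_constant_poly)
  finally show ?thesis .
qed

section \<open>Summing over record sets\<close>

lemma record_seq_le: "x \<in> set (record_seq \<epsilon> \<pi> m) \<Longrightarrow> x \<le> m"
proof (induction \<epsilon> \<pi> m rule: record_seq.induct)
  case (1 \<epsilon> \<pi> m)
  then show ?case
    using candidates_Max_less[of \<epsilon> \<pi> m]
    by (subst (asm) (2) record_seq.simps) (force split: if_splits)
qed

lemma distinct_record_seq: "distinct (record_seq \<epsilon> \<pi> m)"
proof (induction \<epsilon> \<pi> m rule: record_seq.induct)
  case (1 \<epsilon> \<pi> m)
  have "m \<notin> set (record_seq \<epsilon> \<pi> (Max (candidates \<epsilon> \<pi> m)))" if "candidates \<epsilon> \<pi> m \<noteq> {}"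
    using candidates_Max_less[OF that] record_seq_le by fastforce
  with 1 show ?case by (subst record_seq.simps) simp
qed

lemma rec_count_eq_card_Rsub:
  assumes "n \<ge> 1"
  shows "rec_count s n \<epsilon> \<pi> = card (Rsub s n \<epsilon> (Rec n \<epsilon> \<pi>))"
proof -
  let ?xs = "record_seq \<epsilon> \<pi> n"
  let ?J = "{j. 1 \<le> j \<and> j < length ?xs \<and> \<epsilon> (?xs ! j) = s}"
  have first: "?xs ! 0 = n" "0 < length ?xs" by (subst record_seq.simps, simp)+
  have inj: "?xs ! i = ?xs ! j \<longleftrightarrow> i = j" if "i < length ?xs" "j < length ?xs" for i j
    using that by (simp add: nth_eq_iff_index_eq[OF distinct_record_seq])
  have "Rsub s n \<epsilon> (Rec n \<epsilon> \<pi>) = (\<lambda>j. ?xs ! j) ` ?J"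
  proof (intro equalityI subsetI)
    fix i assume "i \<in> Rsub s n \<epsilon> (Rec n \<epsilon> \<pi>)"
    then have i: "i \<in> set ?xs" "i \<noteq> n" "\<epsilon> i = s" using assms by (auto simp: Rsub_def Rec_def)
    then obtain j where j: "j < length ?xs" "?xs ! j = i" by (auto simp: in_set_conv_nth)
    with i first have "j \<noteq> 0" by metis
    with i j show "i \<in> (\<lambda>j. ?xs ! j) ` ?J" by auto
  next
    fix i assume "i \<in> (\<lambda>j. ?xs ! j) ` ?J"
    then obtain j where j: "1 \<le> j" "j < length ?xs" "\<epsilon> i = s" "i = ?xs ! j" by auto
    then have "i \<in> Rec n \<epsilon> \<pi>" "i \<noteq> n" using inj[of j 0] first by (auto simp: Rec_def)
    moreover from this Rec_subset[OF assms] have "i \<in> {1..n-1}" by fastforce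
    ultimately show "i \<in> Rsub s n \<epsilon> (Rec n \<epsilon> \<pi>)" using j by (simp add: Rsub_def)
  qed
  moreover have "inj_on (\<lambda>j. ?xs ! j) ?J" by (rule inj_onI) (use inj in auto)
  ultimately show ?thesis by (simp add: rec_count_def card_image)
qed

lemma record_set_weight_eq_prod:
  assumes "n \<ge> 1" "R \<subseteq> {1..n}"
  shows "p_var ^ card (Rsub Plus n \<epsilon> R) * q_var ^ card (Rsub Minus n \<epsilon> R) * y_mon (R - {n}) =
    (\<Prod>i\<in>R - {n}. rec_weight \<epsilon> i)"
proof -
  have "R - {n} \<subseteq> {1..n-1}"
  proof
    fix i assume "i \<in> R - {n}"
    then have "i \<in> {1..n}" "i \<noteq> n" using assms(2) by auto
    then show "i \<in> {1..n-1}" by auto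
  qed
  moreover have "Rsub s n \<epsilon> (R - {n}) = Rsub s n \<epsilon> R" for s
    using assms(1) by (auto simp: Rsub_def)
  ultimately show ?thesis using prod_rec_weight[of "R - {n}" n \<epsilon>] by simp
qed

lemma y_mon_insert_endpoint: "finite R \<Longrightarrow> n \<in> R \<Longrightarrow> y_mon R = y_var n * y_mon (R - {n})"
  unfolding y_mon_def by (rule prod.remove)

lemma sum_card_Rec:
  fixes g :: "nat set \<Rightarrow> coeffs"
  assumes "n \<ge> 1" "P \<subseteq> {\<pi>. \<pi> permutes {1..n}}"
  shows "(\<Sum>R | R \<subseteq> {1..n} \<and> n \<in> R. of_nat (card {\<pi> \<in> P. Rec n \<epsilon> \<pi> = R}) * g R) =
    (\<Sum>\<pi>\<in>P. g (Rec n \<epsilon> \<pi>))"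
proof -
  have "finite P" using assms(2) finite_permutations[of "{1..n}"] finite_subset by blast
  moreover have "finite {R. R \<subseteq> {1..n} \<and> n \<in> R}" by simp
  moreover have "Rec n \<epsilon> ` P \<subseteq> {R. R \<subseteq> {1..n} \<and> n \<in> R}"
    using Rec_subset[OF assms(1)] n_in_Rec[OF assms(1)] by blast
  ultimately have "(\<Sum>\<pi>\<in>P. g (Rec n \<epsilon> \<pi>)) =
      (\<Sum>R | R \<subseteq> {1..n} \<and> n \<in> R. \<Sum>\<pi> | \<pi> \<in> P \<and> Rec n \<epsilon> \<pi> = R. g (Rec n \<epsilon> \<pi>))"
    by (rule sum.group[symmetric])
  also have "\<dots> = (\<Sum>R | R \<subseteq> {1..n} \<and> n \<in> R. of_nat (card {\<pi> \<in> P. Rec n \<epsilon> \<pi> = R}) * g R)"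
    by (intro sum.cong refl) simp
  finally show ?thesis ..
qed

text \<open>
  By the bijection with linear extensions, \<open>ell\<close> counts the permutations with a given record
  set, so the sum over record sets becomes a sum over the permutations that end in \<open>k\<close>.
\<close>

lemma sum_ell:
  assumes "n \<ge> 1" "k \<in> {1..n}"
  shows "(\<Sum>R | R \<subseteq> {1..n} \<and> n \<in> R. of_nat (ell n \<epsilon> R k) * (\<Prod>i\<in>R - {n}. rec_weight \<epsilon> i)) =
    endpoint_sum \<epsilon> (n - 1) (k - 1)"
proof -
  let ?P = "{\<pi>. \<pi> permutes {1..n} \<and> \<pi> n = k}"
  have "ell n \<epsilon> R k = card {\<pi> \<in> ?P. Rec n \<epsilon> \<pi> = R}" if "R \<subseteq> {1..n}" "n \<in> R" for R
  proof -
    have "{\<pi> \<in> ?P. Rec n \<epsilon> \<pi> = R} = perms_with n \<epsilon> R k" by (auto simp: perms_with_def)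
    then show ?thesis
      using bij_betw_same_card[OF bij_betw_inv_lin_exts(2)[OF assms(1) that]] by (simp add: ell_def)
  qed
  then have "(\<Sum>R | R \<subseteq> {1..n} \<and> n \<in> R. of_nat (ell n \<epsilon> R k) * (\<Prod>i\<in>R - {n}. rec_weight \<epsilon> i)) =
      (\<Sum>R | R \<subseteq> {1..n} \<and> n \<in> R. of_nat (card {\<pi> \<in> ?P. Rec n \<epsilon> \<pi> = R}) * (\<Prod>i\<in>R - {n}. rec_weight \<epsilon> i))"
    by (intro sum.cong refl) simp
  also have "\<dots> = (\<Sum>\<pi>\<in>?P. \<Prod>i\<in>Rec n \<epsilon> \<pi> - {n}. rec_weight \<epsilon> i)"
    by (rule sum_card_Rec[OF assms(1)]) auto
  also have "\<dots> = endpoint_sum \<epsilon> (n - 1) (k - 1)"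
    by (rule sum_perms_eq_endpoint_sum[OF assms])
  finally show ?thesis .
qed

theorem theorem7p5:
  fixes n r :: nat and \<epsilon> :: "nat \<Rightarrow> sign" and w :: "sign list"
  assumes "n \<ge> 1" and "r = n - 1" and "w = rev_word n \<epsilon>"
  shows
    "(\<forall>R k. R \<subseteq> {1..n} \<and> n \<in> R \<and> k \<in> {1..n} \<longrightarrow>
       bij_betw (path_perm n) (paths_with w k R) (perms_with n \<epsilon> R k) \<and>
       bij_betw inv (perms_with n \<epsilon> R k) (lin_exts_at n (record_poset n \<epsilon> R) k) \<and>
       card (paths_with w k R) = card (perms_with n \<epsilon> R k) \<and>
       card (perms_with n \<epsilon> R k) = ell n \<epsilon> R k)
     \<and>
     fact r * K p_var q_var w (rev_word n y_var) =
       (\<Sum>k=1..n. \<Sum>R | R \<subseteq> {1..n} \<and> n \<in> R.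
          smult (of_nat (ell n \<epsilon> R k) * p_var ^ card (Rsub Plus n \<epsilon> R)
                   * q_var ^ card (Rsub Minus n \<epsilon> R) * y_mon (R - {n}))
                (Bern r k))
     \<and>
     smult (y_var n * fact n) (integ 0 1 (K p_var q_var w (rev_word n y_var))) =
       [: \<Sum>\<pi> | \<pi> permutes {1..n}.
            y_mon (Rec n \<epsilon> \<pi>) * p_var ^ rec_count Plus n \<epsilon> \<pi> * q_var ^ rec_count Minus n \<epsilon> \<pi> :]
     \<and>
     (\<Sum>\<pi> | \<pi> permutes {1..n}.
        y_mon (Rec n \<epsilon> \<pi>) * p_var ^ rec_count Plus n \<epsilon> \<pi> * q_var ^ rec_count Minus n \<epsilon> \<pi>) =
     (\<Sum>R | R \<subseteq> {1..n} \<and> n \<in> R.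
        y_mon R * p_var ^ card (Rsub Plus n \<epsilon> R) * q_var ^ card (Rsub Minus n \<epsilon> R)
          * of_nat (card (lin_exts n (record_poset n \<epsilon> R))))"
proof -
  note n = \<open>n \<ge> 1\<close>
  have n_eq: "n = Suc r" using assms(1,2) by simp
  let ?\<R> = "{R. R \<subseteq> {1..n} \<and> n \<in> R}"
  let ?wt = "\<lambda>R. \<Prod>i\<in>R - {n}. rec_weight \<epsilon> i"
  let ?perm_sum = "\<Sum>\<pi> | \<pi> permutes {1..n}.
    y_mon (Rec n \<epsilon> \<pi>) * p_var ^ rec_count Plus n \<epsilon> \<pi> * q_var ^ rec_count Minus n \<epsilon> \<pi>"
  have full_weight: "y_mon R * p_var ^ card (Rsub Plus n \<epsilon> R) * q_var ^ card (Rsub Minus n \<epsilon> R) =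
      y_var n * ?wt R" if "R \<in> ?\<R>" for R
  proof -
    have R: "R \<subseteq> {1..n}" "n \<in> R" "finite R" using that finite_subset by auto
    show ?thesis
      unfolding record_set_weight_eq_prod[OF n R(1), symmetric] y_mon_insert_endpoint[OF R(3,2)]
      by (simp only: ac_simps)
  qed
  have perm_sum: "?perm_sum = (\<Sum>\<pi> | \<pi> permutes {1..n}. y_var n * ?wt (Rec n \<epsilon> \<pi>))"
    unfolding rec_count_eq_card_Rsub[OF n]
    by (intro sum.cong refl full_weight) (use Rec_subset[OF n] n_in_Rec[OF n] in blast)

  have bijections: "bij_betw (path_perm n) (paths_with w k R) (perms_with n \<epsilon> R k) \<and>
       bij_betw inv (perms_with n \<epsilon> R k) (lin_exts_at n (record_poset n \<epsilon> R) k) \<and>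
       card (paths_with w k R) = card (perms_with n \<epsilon> R k) \<and>
       card (perms_with n \<epsilon> R k) = ell n \<epsilon> R k" if "R \<subseteq> {1..n}" "n \<in> R" for R k
    using bij_betw_path_perm[OF n that assms(3), of k] bij_betw_inv_lin_exts(2)[OF n that, of \<epsilon> k]
    by (auto dest: bij_betw_same_card simp: ell_def)

  have "(\<Sum>k=1..n. \<Sum>R\<in>?\<R>. smult (of_nat (ell n \<epsilon> R k) * p_var ^ card (Rsub Plus n \<epsilon> R)
      * q_var ^ card (Rsub Minus n \<epsilon> R) * y_mon (R - {n})) (Bern r k)) =
      (\<Sum>k=1..n. smult (endpoint_sum \<epsilon> r (k - 1)) (Bern r k))"
  proof (intro sum.cong refl)
    fix k assume k: "k \<in> {1..n}"
    have "(\<Sum>R\<in>?\<R>. smult (of_nat (ell n \<epsilon> R k) * p_var ^ card (Rsub Plus n \<epsilon> R)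
        * q_var ^ card (Rsub Minus n \<epsilon> R) * y_mon (R - {n})) (Bern r k)) =
        (\<Sum>R\<in>?\<R>. smult (of_nat (ell n \<epsilon> R k) * ?wt R) (Bern r k))"
      by (intro sum.cong refl arg_cong2[where f = smult])
        (simp add: record_set_weight_eq_prod[OF n, symmetric] mult.assoc)
    also have "\<dots> = smult (endpoint_sum \<epsilon> r (k - 1)) (Bern r k)"
      using sum_ell[OF n k] assms(2) by (simp only: smult_sum[symmetric])
    finally show "(\<Sum>R\<in>?\<R>. smult (of_nat (ell n \<epsilon> R k) * p_var ^ card (Rsub Plus n \<epsilon> R)
        * q_var ^ card (Rsub Minus n \<epsilon> R) * y_mon (R - {n})) (Bern r k)) =
        smult (endpoint_sum \<epsilon> r (k - 1)) (Bern r k)" .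
  qed
  also have "\<dots> = (\<Sum>j\<le>r. smult (endpoint_sum \<epsilon> r j) (bern r j))"
    by (simp only: n_eq One_nat_def sum.atLeast1_atMost_eq lessThan_Suc_atMost bern_def
        diff_Suc_Suc diff_zero)
  also have "\<dots> = fact r * K p_var q_var w (rev_word n y_var)"
    unfolding assms(3) n_eq by (rule fact_K_eq_sum_bern[symmetric])
  finally have expansion: "fact r * K p_var q_var w (rev_word n y_var) =
       (\<Sum>k=1..n. \<Sum>R | R \<subseteq> {1..n} \<and> n \<in> R.
          smult (of_nat (ell n \<epsilon> R k) * p_var ^ card (Rsub Plus n \<epsilon> R)
                   * q_var ^ card (Rsub Minus n \<epsilon> R) * y_mon (R - {n})) (Bern r k))" ..

  have "(\<Sum>j\<le>r. endpoint_sum \<epsilon> r j) = (\<Sum>k\<in>{1..n}. endpoint_sum \<epsilon> (n - 1) (k - 1))"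
    by (simp only: n_eq One_nat_def sum.atLeast1_atMost_eq lessThan_Suc_atMost diff_Suc_Suc diff_zero)
  also have "\<dots> = (\<Sum>k\<in>{1..n}. \<Sum>\<pi> | \<pi> \<in> {\<pi>. \<pi> permutes {1..n}} \<and> \<pi> n = k. ?wt (Rec n \<epsilon> \<pi>))"
    by (intro sum.cong refl) (simp only: mem_Collect_eq sum_perms_eq_endpoint_sum[OF n])
  also have "\<dots> = (\<Sum>\<pi> | \<pi> permutes {1..n}. ?wt (Rec n \<epsilon> \<pi>))"
    by (rule sum.group) (use n permutes_in_image in \<open>fastforce simp: finite_permutations\<close>)+
  finally have total: "?perm_sum = y_var n * (\<Sum>j\<le>r. endpoint_sum \<epsilon> r j)"
    unfolding perm_sum by (simp only: sum_distrib_left)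
  have integral: "smult (y_var n * fact n) (integ 0 1 (K p_var q_var w (rev_word n y_var))) = [:?perm_sum:]"
  proof -
    have "smult (y_var n * fact n) (integ 0 1 (K p_var q_var w (rev_word n y_var))) =
        smult (y_var n) (smult (fact n) (integ 0 1 (K p_var q_var w (rev_word n y_var))))"
      by (simp only: smult_smult)
    also have "\<dots> = smult (y_var n) [:\<Sum>j\<le>r. endpoint_sum \<epsilon> r j:]"
      unfolding assms(3) n_eq fact_integ_K ..
    finally show ?thesis unfolding total by simp
  qed

  have "?perm_sum = (\<Sum>R\<in>?\<R>. of_nat (card {\<pi> \<in> {\<pi>. \<pi> permutes {1..n}}. Rec n \<epsilon> \<pi> = R})
      * (y_var n * ?wt R))"
    unfolding perm_sum by (rule sum_card_Rec[OF n subset_refl, symmetric])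
  also have "\<dots> = (\<Sum>R | R \<subseteq> {1..n} \<and> n \<in> R.
        y_mon R * p_var ^ card (Rsub Plus n \<epsilon> R) * q_var ^ card (Rsub Minus n \<epsilon> R)
          * of_nat (card (lin_exts n (record_poset n \<epsilon> R))))"
  proof (intro sum.cong refl)
    fix R assume R: "R \<in> ?\<R>"
    then have "card {\<pi> \<in> {\<pi>. \<pi> permutes {1..n}}. Rec n \<epsilon> \<pi> = R} = card (lin_exts n (record_poset n \<epsilon> R))"
      using bij_betw_same_card[OF bij_betw_inv_lin_exts(1)[OF n, of R \<epsilon>]] by simp
    then show "of_nat (card {\<pi> \<in> {\<pi>. \<pi> permutes {1..n}}. Rec n \<epsilon> \<pi> = R}) * (y_var n * ?wt R) =
        y_mon R * p_var ^ card (Rsub Plus n \<epsilon> R) * q_var ^ card (Rsub Minus n \<epsilon> R)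
          * of_nat (card (lin_exts n (record_poset n \<epsilon> R)))"
      unfolding full_weight[OF R] by (simp only: mult.commute)
  qed
  finally show ?thesis using bijections expansion integral by blast
qed

end
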